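(* Let $n\ge 2$ and let $(A,B)$ be a regular pair in $\mathbb{C}^{n\times n}$ with distinct generalized eigenvalues and generalized Schur decomposition $A=UTV^H$, $B=URV^H$ ($U,V$ unitary, $T,R$ upper triangular). Let $i\in\{1,\dots,n\}$ be such that $t_{ii}\ne0$ and $r_{ii}\ne 0$, and let $\lambda_i=t_{ii}/r_{ii}$. Then the condition number of the generalized eigenvalue $\lambda_i$ satisfies $$\mathrm{cond}(\lambda_i)\le\frac{\|Z_{i,:}\|_2}{|t_{ii}|}+\frac{\|Z_{i+n,:}\|_2}{|r_{ii}|},$$ where $Z_{k,:}$ is the $k$th row of $Z=[EL^{-1},\,I_{2n}]$.
   Context: The pair $(A,B)$ is regular if $\det(A-\lambda B)\not\equiv 0$; its generalized eigenvalues are the pairs $\langle t_{ii},r_{ii}\rangle$ (regarded projectively, $\lambda_i=t_{ii}/r_{ii}\in\mathbb{C}\cup\{\infty\}$), assumed pairwise distinct. Condition number: for a finite nonzero generalized eigenvalue $\lambda$ with right eigenvector $\xi\neq0$ ($A\xi=\lambda B\xi$), $$\mathrm{cond}(\lambda)=\lim_{\epsilon\to0}\sup\Big\{\frac{|\Delta\lambda|}{\epsilon|\lambda|}:(A+\Delta A)(\xi+\Delta\xi)=(\lambda+\Delta\lambda)(B+\Delta B)(\xi+\Delta\xi),\ \|[\Delta A,\Delta B]\|_F\le\epsilon\Big\},$$ with the convention that $\Delta\xi\to0$ as $\epsilon\to0$. Precisely, this is read as $\lim_{\delta\to0^+}\limsup_{\epsilon\to0^+}$ of the supremum of $|\Delta\lambda|/(\epsilon|\lambda|)$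 over all $(\Delta A,\Delta B,\Delta\xi,\Delta\lambda)$ satisfying the displayed constraints together with $\|\Delta\xi\|_2\le\delta$. Let $\nu=n(n-1)/2$ and, for $i>j$, $l(i,j)=i+(j-1)n-\frac{j(j+1)}{2}\in\{1,\dots,\nu\}$. $\mathrm{slvec}(M)\in\mathbb{C}^\nu$ has $m_{ij}$ ($i>j$) in position $l(i,j)$, and $M_{\rm slvec}$ is the 0-1 matrix with $\mathrm{slvec}(M)=M_{\rm slvec}\mathrm{vec}(M)$ (vec stacks columns). $$L=\begin{bmatrix}-M_{\rm slvec}(T^T\otimes I_n)M_{\rm slvec}^T&M_{\rm slvec}(I_n\otimes T)M_{\rm slvec}^T\\ -M_{\rm slvec}(R^T\otimes I_n)M_{\rm slvec}^T&M_{\rm slvec}(I_n\otimes R)M_{\rm slvec}^T\end{bmatrix}\in\mathbb{C}^{2\nu\times2\nu},$$ which is nonsingular under the stated assumptions. $E=\begin{bmatrix}A_1&A_2\\ B_1&B_2\end{bmatrix}\in\mathbb{C}^{2n\times2\nu}$, where $A_1,A_2\in\mathbb{C}^{n\times\nu}$ have the following entries and zeros elsewhere: row $i$ of $A_1$ has $-t_{ki}$ in column $l(i,k)$ for each $k<i$; row $i$ of $A_2$ has $t_{ik}$ in column $l(k,i)$ for each $k>i$. $B_1,B_2$ are defined in the same way with $r$ in place of $t$. *)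

theory Defs
  imports
    "HOL-Analysis.Analysis"
    "Jordan_Normal_Form.Gauss_Jordan_Elimination"
    "Jordan_Normal_Form.Determinant"
    "Jordan_Normal_Form.Schur_Decomposition"
begin

hide_const (open) Finite_Cartesian_Product.vec Finite_Cartesian_Product.row
  Finite_Cartesian_Product.mat Determinants.det Finite_Cartesian_Product.transpose
no_notation Finite_Cartesian_Product.vec_nth (infixl \<open>$\<close> 90)

definition vec_norm2 :: "complex vec \<Rightarrow> real" where
  "vec_norm2 v = sqrt (\<Sum>k<dim_vec v. (cmod (v $ k))\<^sup>2)"

definition frobenius_norm :: "complex mat \<Rightarrow> real" where
  "frobenius_norm M = sqrt (\<Sum>i<dim_row M. \<Sum>j<dim_col M. (cmod (M $$ (i, j)))\<^sup>2)"

definition append_cols :: "'a :: zero mat \<Rightarrow> 'a mat \<Rightarrow> 'a mat" where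
  "append_cols X Y = four_block_mat X Y (0\<^sub>m 0 (dim_col X)) (0\<^sub>m 0 (dim_col Y))"

definition kronecker :: "'a :: times mat \<Rightarrow> 'a mat \<Rightarrow> 'a mat" where
  "kronecker X Y = mat (dim_row X * dim_row Y) (dim_col X * dim_col Y)
     (\<lambda>(p, q). X $$ (p div dim_row Y, q div dim_col Y) * Y $$ (p mod dim_row Y, q mod dim_col Y))"

definition vec_stack :: "'a mat \<Rightarrow> 'a vec" where
  "vec_stack M = vec (dim_row M * dim_col M) (\<lambda>q. M $$ (q mod dim_row M, q div dim_row M))"

definition unitary_mat :: "complex mat \<Rightarrow> bool" where
  "unitary_mat U \<longleftrightarrow> square_mat U \<and> mat_adjoint U * U = 1\<^sub>m (dim_row U)"

definition regular_pair :: "complex mat \<Rightarrow> complex mat \<Rightarrow> bool" where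
  "regular_pair A B \<longleftrightarrow> (\<exists>\<mu>. det (A - \<mu> \<cdot>\<^sub>m B) \<noteq> 0)"

definition generalized_schur ::
  "nat \<Rightarrow> complex mat \<Rightarrow> complex mat \<Rightarrow> complex mat \<Rightarrow> complex mat \<Rightarrow> complex mat \<Rightarrow> complex mat \<Rightarrow> bool"
  where
  "generalized_schur n A B U V T R \<longleftrightarrow>
     {A, B, U, V, T, R} \<subseteq> carrier_mat n n \<and>
     unitary_mat U \<and> unitary_mat V \<and> upper_triangular T \<and> upper_triangular R \<and>
     A = U * T * mat_adjoint V \<and> B = U * R * mat_adjoint V"

text \<open>For a regular pair no diagonal pair \<open>(t\<^sub>i\<^sub>i, r\<^sub>i\<^sub>i)\<close> is \<open>(0, 0)\<close>, so the
  relation below is equality of points of the projective line.\<close>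

definition proj_equal :: "complex \<times> complex \<Rightarrow> complex \<times> complex \<Rightarrow> bool" where
  "proj_equal p q \<longleftrightarrow> (\<exists>s. s \<noteq> 0 \<and> fst p = s * fst q \<and> snd p = s * snd q)"

definition distinct_gen_eigenvalues :: "nat \<Rightarrow> complex mat \<Rightarrow> complex mat \<Rightarrow> bool" where
  "distinct_gen_eigenvalues n T R \<longleftrightarrow>
     (\<forall>i<n. \<forall>j<n. i \<noteq> j \<longrightarrow>
        \<not> proj_equal (T $$ (i, i), R $$ (i, i)) (T $$ (j, j), R $$ (j, j)))"

definition eigenvalue_perturbations ::
  "complex mat \<Rightarrow> complex mat \<Rightarrow> complex \<Rightarrow> complex vec \<Rightarrow> real \<Rightarrow> real \<Rightarrow> complex set" where
  "eigenvalue_perturbations A B lam \<xi> \<delta> \<epsilon> =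
     {dlam. \<exists>dA dB d\<xi>.
        dA \<in> carrier_mat (dim_row A) (dim_col A) \<and> dB \<in> carrier_mat (dim_row A) (dim_col A) \<and>
        d\<xi> \<in> carrier_vec (dim_col A) \<and>
        (A + dA) *\<^sub>v (\<xi> + d\<xi>) = (lam + dlam) \<cdot>\<^sub>v ((B + dB) *\<^sub>v (\<xi> + d\<xi>)) \<and>
        frobenius_norm (append_cols dA dB) \<le> \<epsilon> \<and> vec_norm2 d\<xi> \<le> \<delta>}"

text \<open>Only a neighbourhood of the eigenvector \<open>\<xi>\<close> is searched: \<open>\<delta>\<close> bounds its perturbation and
  tends to \<open>0\<close> after \<open>\<epsilon>\<close>. The supremum over the perturbations can be infinite when \<open>\<delta>\<close> is large,
  so the limits are taken in the extended reals.\<close>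

definition gen_cond_upto ::
  "complex mat \<Rightarrow> complex mat \<Rightarrow> complex \<Rightarrow> complex vec \<Rightarrow> real \<Rightarrow> ereal" where
  "gen_cond_upto A B lam \<xi> \<delta> =
     Limsup (at_right 0) (\<lambda>\<epsilon>.
       SUP dlam \<in> eigenvalue_perturbations A B lam \<xi> \<delta> \<epsilon>. ereal (cmod dlam / (\<epsilon> * cmod lam)))"

definition gen_cond :: "complex mat \<Rightarrow> complex mat \<Rightarrow> complex \<Rightarrow> complex vec \<Rightarrow> ereal" where
  "gen_cond A B lam \<xi> = Lim (at_right 0) (gen_cond_upto A B lam \<xi>)"

lemma gen_cond_upto_mono:
  assumes "\<delta> \<le> \<delta>'"
  shows "gen_cond_upto A B lam \<xi> \<delta> \<le> gen_cond_upto A B lam \<xi> \<delta>'"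
  unfolding gen_cond_upto_def
proof (intro Limsup_mono always_eventually allI SUP_subset_mono order_refl)
  show "eigenvalue_perturbations A B lam \<xi> \<delta> \<epsilon> \<subseteq> eigenvalue_perturbations A B lam \<xi> \<delta>' \<epsilon>" for \<epsilon>
    unfolding eigenvalue_perturbations_def using assms order_trans by blast
qed

lemma gen_cond_tendsto:
  "(gen_cond_upto A B lam \<xi> \<longlongrightarrow> gen_cond A B lam \<xi>) (at_right 0)"
  and gen_cond_eq_INF: "gen_cond A B lam \<xi> = (INF \<delta>\<in>{0<..}. gen_cond_upto A B lam \<xi> \<delta>)"
proof -
  let ?f = "gen_cond_upto A B lam \<xi>"
  have lim: "(?f \<longlongrightarrow> (INF \<delta>\<in>{0<..}. ?f \<delta>)) (at_right 0)"
  proof (rule order_tendstoI)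
    fix a assume "a < (INF \<delta>\<in>{0<..}. ?f \<delta>)"
    then have "a < ?f \<delta>" if "\<delta> > 0" for \<delta>
      using that by (meson INF_lower greaterThan_iff less_le_trans)
    then show "\<forall>\<^sub>F \<delta> in at_right 0. a < ?f \<delta>"
      by (auto simp: eventually_at_filter)
  next
    fix a assume "(INF \<delta>\<in>{0<..}. ?f \<delta>) < a"
    then obtain d where d: "d > 0" "?f d < a"
      by (auto simp: INF_less_iff)
    then have "?f \<delta> < a" if "0 < \<delta>" "\<delta> < d" for \<delta>
      using gen_cond_upto_mono[of \<delta> d A B lam \<xi>] that by (meson le_less_trans less_imp_le)
    then show "\<forall>\<^sub>F \<delta> in at_right 0. ?f \<delta> < a"
      using d(1) by (auto simp: eventually_at_right_field)
  qed
  then have eq: "gen_cond A B lam \<xi> = (INF \<delta>\<in>{0<..}. ?f \<delta>)"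
    unfolding gen_cond_def by (intro tendsto_Lim) auto
  from eq show "gen_cond A B lam \<xi> = (INF \<delta>\<in>{0<..}. ?f \<delta>)" .
  from lim eq show "(?f \<longlongrightarrow> gen_cond A B lam \<xi>) (at_right 0)" by simp
qed

definition num_sl :: "nat \<Rightarrow> nat" where
  "num_sl n = n * (n - 1) div 2"

text \<open>Position \<open>l(i,j)\<close> with the customary one-based indices \<open>1 \<le> j < i \<le> n\<close>,
  and its zero-based counterpart, which matches the indexing of \<^typ>\<open>'a mat\<close>.\<close>

definition sl_pos :: "nat \<Rightarrow> nat \<Rightarrow> nat \<Rightarrow> nat" where
  "sl_pos n i j = i + (j - 1) * n - j * (j + 1) div 2"

definition sl_idx :: "nat \<Rightarrow> nat \<Rightarrow> nat \<Rightarrow> nat" where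
  "sl_idx n i j = sl_pos n (Suc i) (Suc j) - 1"

text \<open>Column \<open>i + j * n\<close> is the position of entry \<open>(i, j)\<close> in \<^const>\<open>vec_stack\<close>.\<close>

definition M_slvec :: "nat \<Rightarrow> complex mat" where
  "M_slvec n = mat (num_sl n) (n * n)
     (\<lambda>(p, q). if \<exists>i j. j < i \<and> i < n \<and> p = sl_idx n i j \<and> q = i + j * n then 1 else 0)"

lemma sl_idx_double:
  assumes "j < i" "i < n"
  shows "2 * int (sl_idx n i j) = 2 * int i + 2 * int j * int n - (int j + 1) * (int j + 2)"
proof -
  have ev: "2 * ((j + 1) * (j + 2) div 2) = (j + 1) * (j + 2)" by simp
  have "(j + 1) * (j + 2) \<le> 2 * (j + 1) + j * (j + 1)" by (simp add: algebra_simps)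
  also have "\<dots> \<le> 2 * i + j * n" 
    using assms by (intro add_mono mult_le_mono) auto
  finally have le: "(j + 1) * (j + 2) \<le> 2 * i + 2 * (j * n)" by linarith
  define h where "h = (j + 1) * (j + 2) div 2"
  have h: "2 * h = (j + 1) * (j + 2)" using ev by (simp add: h_def)
  have "sl_idx n i j = Suc i + j * n - h - 1"
    by (simp add: sl_idx_def sl_pos_def h_def)
  moreover have "h \<le> i + j * n" using le h by linarith
  ultimately have "int (sl_idx n i j) = int i + int j * int n - int h" by (simp add: of_nat_diff)
  moreover have "2 * int h = (int j + 1) * (int j + 2)"
    using arg_cong[OF h, of int] by (simp add: algebra_simps)
  ultimately show ?thesis by (simp add: algebra_simps)
qed

lemma sl_block_mono:
  fixes j j' n :: int
  assumes "0 \<le> j" "j \<le> j'" "j' \<le> n - 1"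
  shows "2 * j * n - j * j - j \<le> 2 * j' * n - j' * j' - j'"
proof -
  have "0 \<le> (j' - j) * (2 * n - j' - j - 1)" using assms by (intro mult_nonneg_nonneg) auto
  then show ?thesis by (simp add: algebra_simps)
qed

lemma sl_idx_bounds:
  assumes "j < i" "i < n"
  defines "f \<equiv> \<lambda>k. 2 * k * int n - k * k - k"
  shows "f (int j) \<le> 2 * int (sl_idx n i j)" "2 * int (sl_idx n i j) < f (int j + 1)"
proof -
  define X where "X = 2 * int i + 2 * int j * int n - (int j + 1) * (int j + 2)"
  have f: "f (int j) = X - 2 * (int i - int j - 1)" "f (int j + 1) = X + 2 * (int n - int i)"
    by (simp_all add: f_def X_def algebra_simps)
  have X: "2 * int (sl_idx n i j) = X"
    using sl_idx_double[OF assms(1,2)] by (simp only: X_def)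
  show "f (int j) \<le> 2 * int (sl_idx n i j)"
    using assms(1) unfolding f(1) X by simp
  show "2 * int (sl_idx n i j) < f (int j + 1)"
    using assms(2) unfolding f(2) X by simp
qed

lemma sl_idx_inj:
  assumes "j < i" "i < n" "j' < i'" "i' < n" "sl_idx n i j = sl_idx n i' j'"
  shows "i = i' \<and> j = j'"
proof -
  have *: "sl_idx n i j < sl_idx n i' j'" if "j < j'" "j < i" "i < n" "j' < i'" "i' < n" for i j i' j'
  proof -
    have le: "0 \<le> int j + 1" "int j + 1 \<le> int j'" "int j' \<le> int n - 1" using that by simp_all
    have "2 * int (sl_idx n i j) < 2 * int (sl_idx n i' j')"
      by (rule order.strict_trans2[OF sl_idx_bounds(2)[OF that(2,3)]
            order_trans[OF sl_block_mono[OF le] sl_idx_bounds(1)[OF that(4,5)]]])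
    then show ?thesis by simp
  qed
  have "j = j'"
    using *[OF _ assms(1-4)] *[OF _ assms(3,4,1,2)] assms(5)
    by (cases j j' rule: linorder_cases) simp_all
  moreover have "i = i'"
  proof -
    have "2 * int (sl_idx n i j) = 2 * int (sl_idx n i' j')" by (simp only: assms(5))
    then show ?thesis
      unfolding sl_idx_double[OF assms(1,2)] sl_idx_double[OF assms(3,4)]
      unfolding \<open>j = j'\<close> by simp
  qed
  ultimately show ?thesis by simp
qed

lemma sl_idx_less:
  assumes "j < i" "i < n"
  shows "sl_idx n i j < num_sl n"
proof -
  have le: "0 \<le> int j + 1" "int j + 1 \<le> int n - 1" using assms by simp_all
  have "2 * int (sl_idx n i j) < 2 * (int n - 1) * int n - (int n - 1) * (int n - 1) - (int n - 1)"
    by (rule order.strict_trans2[OF sl_idx_bounds(2)[OF assms] sl_block_mono[OF le order_refl]])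
  also have "\<dots> = int (n * (n - 1))"
    using assms by (simp add: of_nat_diff algebra_simps)
  finally have "2 * sl_idx n i j < n * (n - 1)" by linarith
  moreover have "2 * num_sl n = n * (n - 1)" by (cases n) (simp_all add: num_sl_def)
  ultimately show ?thesis by linarith
qed

lemma sl_idx_bij:
  "bij_betw (\<lambda>(i, j). sl_idx n i j) {(i, j). j < i \<and> i < n} {..<num_sl n}"
proof -
  let ?S = "{(i, j). j < i \<and> i < n}"
  have S: "?S = (SIGMA i:{..<n}. {..<i})" by auto
  have inj: "inj_on (\<lambda>(i, j). sl_idx n i j) ?S"
  proof (rule inj_onI)
    fix p q
    assume "p \<in> ?S" "q \<in> ?S" "(\<lambda>(i, j). sl_idx n i j) p = (\<lambda>(i, j). sl_idx n i j) q"
    then show "p = q"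
      using sl_idx_inj[of "snd p" "fst p" n "snd q" "fst q"] by (cases p; cases q) simp
  qed
  have "card ?S = \<Sum>{..<n}" unfolding S by simp
  also have "\<dots> = num_sl n"
  proof (cases n)
    case (Suc m)
    then have "{..<n} = {0..m}" by auto
    then show ?thesis using gauss_sum_nat[of m] Suc by (simp add: num_sl_def mult.commute)
  qed (simp add: num_sl_def)
  finally have "card ((\<lambda>(i, j). sl_idx n i j) ` ?S) = card {..<num_sl n}"
    using inj by (simp add: card_image)
  then have "(\<lambda>(i, j). sl_idx n i j) ` ?S = {..<num_sl n}"
    by (intro card_subset_eq) (auto simp: sl_idx_less)
  with inj show ?thesis by (simp add: bij_betw_def)
qed

lemma M_slvec_vec_stack:
  assumes M: "M \<in> carrier_mat n n" and ij: "j < i" "i < n"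
  shows "(M_slvec n *\<^sub>v vec_stack M) $ sl_idx n i j = M $$ (i, j)"
proof -
  have q: "i + j * n < n * n"
  proof -
    have "i + j * n < Suc j * n" using ij by simp
    also have "\<dots> \<le> n * n" using ij by (intro mult_le_mono) auto
    finally show ?thesis .
  qed
  have entry: "M_slvec n $$ (sl_idx n i j, q) = (if q = i + j * n then 1 else 0)"
    if "q < n * n" for q
  proof -
    have "(\<exists>i' j'. j' < i' \<and> i' < n \<and> sl_idx n i j = sl_idx n i' j' \<and> q = i' + j' * n) \<longleftrightarrow> q = i + j * n"
      using ij sl_idx_inj[OF ij] by metis
    then show ?thesis using that sl_idx_less[OF ij] by (simp add: M_slvec_def)
  qed
  have "(M_slvec n *\<^sub>v vec_stack M) $ sl_idx n i j =
      (\<Sum>q\<in>{0..<n * n}. M_slvec n $$ (sl_idx n i j, q) * vec_stack M $ q)"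
    using M sl_idx_less[OF ij] by (simp add: scalar_prod_def vec_stack_def M_slvec_def)
  also have "\<dots> = (\<Sum>q\<in>{0..<n * n}. if q = i + j * n then vec_stack M $ q else 0)"
    by (intro sum.cong) (auto simp: entry)
  also have "\<dots> = vec_stack M $ (i + j * n)" using q by simp
  also have "\<dots> = M $$ (i, j)" using M q ij by (simp add: vec_stack_def)
  finally show ?thesis .
qed

definition L_mat :: "nat \<Rightarrow> complex mat \<Rightarrow> complex mat \<Rightarrow> complex mat" where
  "L_mat n T R = (let M = M_slvec n in
     four_block_mat
       (- (M * kronecker (transpose_mat T) (1\<^sub>m n) * transpose_mat M))
       (M * kronecker (1\<^sub>m n) T * transpose_mat M)
       (- (M * kronecker (transpose_mat R) (1\<^sub>m n) * transpose_mat M))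
       (M * kronecker (1\<^sub>m n) R * transpose_mat M))"

text \<open>At most one summand below is nonzero, by injectivity of \<^const>\<open>sl_idx\<close>.\<close>

definition E_left :: "nat \<Rightarrow> complex mat \<Rightarrow> complex mat" where
  "E_left n X = mat n (num_sl n) (\<lambda>(i, p). \<Sum>k<i. if p = sl_idx n i k then - X $$ (k, i) else 0)"

definition E_right :: "nat \<Rightarrow> complex mat \<Rightarrow> complex mat" where
  "E_right n X =
     mat n (num_sl n) (\<lambda>(i, p). \<Sum>k\<in>{i<..<n}. if p = sl_idx n k i then X $$ (i, k) else 0)"

definition E_mat :: "nat \<Rightarrow> complex mat \<Rightarrow> complex mat \<Rightarrow> complex mat" where
  "E_mat n T R = four_block_mat (E_left n T) (E_right n T) (E_left n R) (E_right n R)"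

text \<open>\<^const>\<open>L_mat\<close> is nonsingular when the pair is regular with distinct generalized eigenvalues.\<close>

definition Z_mat :: "nat \<Rightarrow> complex mat \<Rightarrow> complex mat \<Rightarrow> complex mat" where
  "Z_mat n T R = append_cols (E_mat n T R * the (mat_inverse (L_mat n T R))) (1\<^sub>m (2 * n))"

end

theory Submission
  imports Defs
begin

text \<open>
  Let \<open>z\<close> be a left eigenvector for \<open>\<lambda>\<^sub>i\<close>. Multiplying the perturbed eigenvalue equation by \<open>z\<close>
  gives, to first order, \<open>\<Delta>\<lambda> (z B \<xi>) = z \<Delta>A \<xi> - \<lambda>\<^sub>i z \<Delta>B \<xi>\<close>. In Schur coordinates the eigenvectors become
  \<open>y\<close>, \<open>x\<close> with \<open>y\<^sub>j = 0\<close> for \<open>j < i\<close> and \<open>x\<^sub>j = 0\<close> for \<open>j > i\<close>, and the right-hand side becomes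
  \<open>y \<Delta>T x - \<lambda>\<^sub>i y \<Delta>R x\<close>. This functional vanishes on the pairs \<open>(TQ - PT, RQ - PR)\<close>. Solving with
  \<open>L\<close> for strictly lower triangular \<open>P\<close>, \<open>Q\<close> makes \<open>\<Delta>T - (TQ - PT)\<close> and \<open>\<Delta>R - (RQ - PR)\<close> upper triangular,
  so that only their \<open>i\<close>-th diagonal entries contribute. These are the entries \<open>i\<close> and
  \<open>i + n\<close> of \<open>Z g\<close>, where \<open>g\<close> stacks \<open>-slvec \<Delta>T\<close>, \<open>-slvec \<Delta>R\<close> and the diagonals of \<open>\<Delta>T\<close>, \<open>\<Delta>R\<close>,
  and the norm of \<open>g\<close> is at most that of \<open>[\<Delta>T, \<Delta>R]\<close>.
\<close>

section \<open>Norms of complex vectors and matrices\<close>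

lemma vec_norm2_L2_set: "vec_norm2 v = L2_set (\<lambda>k. cmod (v $ k)) {..<dim_vec v}"
  by (simp add: vec_norm2_def L2_set_def)

lemma vec_norm2_nonneg [simp]: "0 \<le> vec_norm2 v"
  by (simp add: vec_norm2_L2_set)

lemma vec_norm2_sq: "(vec_norm2 v)\<^sup>2 = (\<Sum>k<dim_vec v. (cmod (v $ k))\<^sup>2)"
  unfolding vec_norm2_def by (intro real_sqrt_pow2 sum_nonneg) auto

text \<open>The product \<open>\<bullet>\<close> is bilinear, without conjugation. The inequality
  survives because the proof passes to absolute values term by term before using the real version
  for \<open>L2_set\<close>.\<close>

lemma scalar_prod_Cauchy_Schwarz:
  assumes "dim_vec v = dim_vec w"
  shows "cmod (v \<bullet> w) \<le> vec_norm2 v * vec_norm2 w"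
proof -
  have "cmod (v \<bullet> w) \<le> (\<Sum>k<dim_vec w. \<bar>cmod (v $ k)\<bar> * \<bar>cmod (w $ k)\<bar>)"
    unfolding scalar_prod_def atLeast0LessThan
    by (intro order.trans[OF norm_sum]) (simp add: norm_mult)
  also have "\<dots> \<le> vec_norm2 v * vec_norm2 w"
    unfolding vec_norm2_L2_set assms by (rule L2_set_mult_ineq)
  finally show ?thesis .
qed

lemma vec_norm2_add:
  assumes "dim_vec v = dim_vec w"
  shows "vec_norm2 (v + w) \<le> vec_norm2 v + vec_norm2 w"
proof -
  have "vec_norm2 (v + w) \<le> L2_set (\<lambda>k. cmod (v $ k) + cmod (w $ k)) {..<dim_vec w}"
    unfolding vec_norm2_L2_set using assms
    by (auto intro!: L2_set_mono norm_triangle_ineq)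
  also have "\<dots> \<le> vec_norm2 v + vec_norm2 w"
    unfolding vec_norm2_L2_set assms by (rule L2_set_triangle_ineq)
  finally show ?thesis .
qed

lemma frobenius_norm_nonneg [simp]: "0 \<le> frobenius_norm M"
  unfolding frobenius_norm_def by (intro real_sqrt_ge_zero sum_nonneg) auto

lemma frobenius_norm_sq:
  "(frobenius_norm M)\<^sup>2 = (\<Sum>i<dim_row M. \<Sum>j<dim_col M. (cmod (M $$ (i, j)))\<^sup>2)"
  unfolding frobenius_norm_def by (intro real_sqrt_pow2 sum_nonneg) auto

text \<open>Cauchy-Schwarz on each row. Bounding the operator norm by the Frobenius norm is crude,
  but it serves only to control the error terms in \<open>gen_cond_le\<close>, which vanish in the
  limit.\<close>

lemma vec_norm2_mult_mat_vec:
  assumes "dim_col M = dim_vec v"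
  shows "vec_norm2 (M *\<^sub>v v) \<le> frobenius_norm M * vec_norm2 v"
proof (rule power2_le_imp_le)
  have "(vec_norm2 (M *\<^sub>v v))\<^sup>2 = (\<Sum>i<dim_row M. (cmod (row M i \<bullet> v))\<^sup>2)"
    unfolding vec_norm2_sq by simp
  also have "\<dots> \<le> (\<Sum>i<dim_row M. (vec_norm2 (row M i) * vec_norm2 v)\<^sup>2)"
    using assms by (intro sum_mono power_mono scalar_prod_Cauchy_Schwarz) auto
  also have "\<dots> = (\<Sum>i<dim_row M. (vec_norm2 (row M i))\<^sup>2) * (vec_norm2 v)\<^sup>2"
    by (simp add: power_mult_distrib sum_distrib_right)
  also have "(\<Sum>i<dim_row M. (vec_norm2 (row M i))\<^sup>2) = (frobenius_norm M)\<^sup>2"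
    unfolding frobenius_norm_sq vec_norm2_sq by simp
  finally show "(vec_norm2 (M *\<^sub>v v))\<^sup>2 \<le> (frobenius_norm M * vec_norm2 v)\<^sup>2"
    by (simp add: power_mult_distrib)
qed auto

lemma bilinear_form_bound:
  assumes "M \<in> carrier_mat m n" "z \<in> carrier_vec m" "v \<in> carrier_vec n"
  shows "cmod (z \<bullet> (M *\<^sub>v v)) \<le> vec_norm2 z * (frobenius_norm M * vec_norm2 v)"
proof -
  have "cmod (z \<bullet> (M *\<^sub>v v)) \<le> vec_norm2 z * vec_norm2 (M *\<^sub>v v)"
    using assms by (intro scalar_prod_Cauchy_Schwarz) auto
  also have "\<dots> \<le> vec_norm2 z * (frobenius_norm M * vec_norm2 v)"
    using assms by (intro mult_left_mono vec_norm2_mult_mat_vec) auto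
  finally show ?thesis .
qed

lemma sum_lessThan_add:
  fixes f :: "nat \<Rightarrow> 'a :: comm_monoid_add"
  shows "sum f {..<m + n} = sum f {..<m} + (\<Sum>k<n. f (m + k))"
  by (induction n) (simp_all add: ac_simps)

lemma frobenius_norm_append_cols:
  assumes "dim_row X = dim_row Y"
  shows "(frobenius_norm (append_cols X Y))\<^sup>2 = (frobenius_norm X)\<^sup>2 + (frobenius_norm Y)\<^sup>2"
  unfolding frobenius_norm_sq append_cols_def using assms
  by (simp add: sum_lessThan_add sum.distrib)

lemma vec_norm2_append:
  "(vec_norm2 (v @\<^sub>v w))\<^sup>2 = (vec_norm2 v)\<^sup>2 + (vec_norm2 w)\<^sup>2"
  unfolding vec_norm2_sq by (simp add: sum_lessThan_add)

lemma frobenius_norm_append_cols_ge: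
  assumes "dim_row X = dim_row Y"
  shows "frobenius_norm X \<le> frobenius_norm (append_cols X Y)"
    and "frobenius_norm Y \<le> frobenius_norm (append_cols X Y)"
  by (rule power2_le_imp_le, simp add: frobenius_norm_append_cols[OF assms], simp)+

section \<open>Unitary invariance of the Frobenius norm\<close>

lemma index_mult_mat_sum:
  assumes "A \<in> carrier_mat m n" "B \<in> carrier_mat n p" "i < m" "j < p"
  shows "(A * B) $$ (i, j) = (\<Sum>k<n. A $$ (i, k) * B $$ (k, j))"
  using assms by (simp add: scalar_prod_def atLeast0LessThan)

lemma index_mult_mat_vec_sum:
  assumes "A \<in> carrier_mat m n" "v \<in> carrier_vec n" "i < m"
  shows "(A *\<^sub>v v) $ i = (\<Sum>k<n. A $$ (i, k) * v $ k)"
  using assms by (simp add: scalar_prod_def atLeast0LessThan)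

section \<open>Adjoints and unitary matrices\<close>

lemma mat_adjoint_dim [simp]:
  "dim_row (mat_adjoint M) = dim_col M" "dim_col (mat_adjoint M) = dim_row M"
  by (simp_all add: mat_adjoint_def)

lemma mat_adjoint_carrier [simp]: "mat_adjoint M \<in> carrier_mat n m \<longleftrightarrow> M \<in> carrier_mat m n"
  unfolding carrier_mat_def by simp blast

lemma mat_adjoint_index:
  fixes M :: "complex mat"
  assumes "i < dim_col M" "j < dim_row M"
  shows "mat_adjoint M $$ (i, j) = cnj (M $$ (j, i))"
  using assms by (simp add: mat_adjoint_def mat_of_rows_index)

lemma mat_adjoint_adjoint:
  fixes M :: "complex mat"
  shows "mat_adjoint (mat_adjoint M) = M"
  by (intro eq_matI) (simp_all add: mat_adjoint_index)

lemma mat_adjoint_mult: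
  fixes A B :: "complex mat"
  assumes "A \<in> carrier_mat m n" "B \<in> carrier_mat n p"
  shows "mat_adjoint (A * B) = mat_adjoint B * mat_adjoint A"
proof (rule eq_matI, goal_cases)
  case (1 i j)
  have ij: "i < p" "j < m" using 1 assms by auto
  have "mat_adjoint (A * B) $$ (i, j) = (\<Sum>k<n. cnj (A $$ (j, k) * B $$ (k, i)))"
    using ij assms by (simp add: mat_adjoint_index index_mult_mat_sum[OF assms] del: index_mult_mat(1))
  also have "\<dots> = (\<Sum>k<n. mat_adjoint B $$ (i, k) * mat_adjoint A $$ (k, j))"
    using ij assms by (intro sum.cong) (auto simp: mat_adjoint_index)
  also have "\<dots> = (mat_adjoint B * mat_adjoint A) $$ (i, j)"
    using ij assms by (subst index_mult_mat_sum[of _ p n _ m]) auto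
  finally show ?case .
qed (use assms in auto)

lemma unitary_mat_adjoint_left:
  assumes "unitary_mat U" "U \<in> carrier_mat n n"
  shows "mat_adjoint U * U = 1\<^sub>m n"
  using assms by (simp add: unitary_mat_def carrier_matD(1))

text \<open>\<open>unitary_mat\<close> only asks for a left inverse; for a square matrix this
  inverse is two-sided.\<close>

lemma unitary_mat_adjoint_right:
  assumes "unitary_mat U" "U \<in> carrier_mat n n"
  shows "U * mat_adjoint U = 1\<^sub>m n"
  using mat_mult_left_right_inverse[of "mat_adjoint U" n U] unitary_mat_adjoint_left[OF assms]
    assms(2) by simp

lemma unitary_mat_adjoint:
  assumes "unitary_mat U" "U \<in> carrier_mat n n"
  shows "unitary_mat (mat_adjoint U)"
  using unitary_mat_adjoint_right[OF assms] assms(2)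
  by (auto simp: unitary_mat_def mat_adjoint_adjoint)

text \<open>The squared norm is the trace of the Gram matrix \<open>mat_adjoint M * M\<close>. A
  unitary factor on the left of \<open>M\<close> cancels in the Gram matrix, which yields the
  invariance below; a factor on the right is treated by taking adjoints.\<close>

lemma frobenius_norm_sq_adjoint:
  "complex_of_real ((frobenius_norm M)\<^sup>2) = (\<Sum>j<dim_col M. (mat_adjoint M * M) $$ (j, j))"
proof -
  have "complex_of_real ((frobenius_norm M)\<^sup>2) =
      (\<Sum>j<dim_col M. \<Sum>i<dim_row M. complex_of_real ((cmod (M $$ (i, j)))\<^sup>2))"
    unfolding frobenius_norm_sq by (subst sum.swap) simp
  also have "\<dots> = (\<Sum>j<dim_col M. (mat_adjoint M * M) $$ (j, j))"
    by (intro sum.cong refl, subst index_mult_mat_sum[of _ _ "dim_row M"])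
      (auto simp: mat_adjoint_index complex_norm_square mult.commute simp del: of_real_power
        intro!: sum.cong)
  finally show ?thesis .
qed

lemma frobenius_norm_adjoint: "frobenius_norm (mat_adjoint M) = frobenius_norm M"
  unfolding frobenius_norm_def by (subst sum.swap) (simp add: mat_adjoint_index)

lemma frobenius_norm_unitary_left:
  assumes W: "unitary_mat W" "W \<in> carrier_mat n n" and M: "M \<in> carrier_mat n m"
  shows "frobenius_norm (W * M) = frobenius_norm M"
proof -
  have "mat_adjoint (W * M) * (W * M) = mat_adjoint M * mat_adjoint W * (W * M)"
    using mat_adjoint_mult[OF W(2) M] by simp
  also have "\<dots> = mat_adjoint M * (mat_adjoint W * (W * M))"
    using W M by (intro assoc_mult_mat) auto
  also have "mat_adjoint W * (W * M) = mat_adjoint W * W * M"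
    using W M by (intro assoc_mult_mat[symmetric]) auto
  also have "\<dots> = M"
    using unitary_mat_adjoint_left[OF W] M by simp
  finally have "complex_of_real ((frobenius_norm (W * M))\<^sup>2) = complex_of_real ((frobenius_norm M)\<^sup>2)"
    unfolding frobenius_norm_sq_adjoint using W M by simp
  then have "(frobenius_norm (W * M))\<^sup>2 = (frobenius_norm M)\<^sup>2"
    by (simp only: of_real_eq_iff)
  then show ?thesis
    by (simp add: power2_eq_iff_nonneg)
qed

lemma frobenius_norm_unitary_right:
  assumes W: "unitary_mat W" "W \<in> carrier_mat n n" and M: "M \<in> carrier_mat m n"
  shows "frobenius_norm (M * W) = frobenius_norm M"
proof -
  have "frobenius_norm (M * W) = frobenius_norm (mat_adjoint W * mat_adjoint M)"
    using mat_adjoint_mult[OF M W(2)] frobenius_norm_adjoint[of "M * W"] by simp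
  also have "\<dots> = frobenius_norm M"
    using frobenius_norm_unitary_left[OF unitary_mat_adjoint[OF W], where M = "mat_adjoint M" and m = m] W M
    by (simp add: frobenius_norm_adjoint)
  finally show ?thesis .
qed


section \<open>First-order perturbation of an eigenvalue\<close>

text \<open>Pairing the perturbed equation with the left eigenvector \<open>z\<close> removes the
  terms of first order in the eigenvector perturbation. What remains is \<open>dlam\<close> times a
  number close to \<open>z \<bullet> (B *\<^sub>v \<xi>)\<close> on one side, and on the other the
  functional bounded by \<open>K\<close> plus products of two small quantities. The hypothesis
  \<open>left\<close> pairs \<open>z\<close> with arbitrary vectors, so that no transpose or adjoint
  of \<open>A\<close> and \<open>B\<close> enters.\<close>

lemma gen_cond_le:
  assumes A: "A \<in> carrier_mat n n" and B: "B \<in> carrier_mat n n"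
    and \<xi>: "\<xi> \<in> carrier_vec n" and z: "z \<in> carrier_vec n" and lam: "lam \<noteq> 0"
    and right: "A *\<^sub>v \<xi> = lam \<cdot>\<^sub>v (B *\<^sub>v \<xi>)"
    and left: "\<And>v. v \<in> carrier_vec n \<Longrightarrow> z \<bullet> (A *\<^sub>v v) = lam * (z \<bullet> (B *\<^sub>v v))"
    and nz: "z \<bullet> (B *\<^sub>v \<xi>) \<noteq> 0"
    and K: "\<And>dA dB. dA \<in> carrier_mat n n \<Longrightarrow> dB \<in> carrier_mat n n \<Longrightarrow>
      cmod (z \<bullet> (dA *\<^sub>v \<xi>) - lam * (z \<bullet> (dB *\<^sub>v \<xi>))) \<le> K * frobenius_norm (append_cols dA dB)"
  shows "gen_cond A B lam \<xi> \<le> ereal (K / (cmod (z \<bullet> (B *\<^sub>v \<xi>)) * cmod lam))"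
proof (rule ereal_le_epsilon2)
  fix e :: real assume "0 < e"
  define \<beta> where "\<beta> = z \<bullet> (B *\<^sub>v \<xi>)"
  define c where "c = K / (cmod \<beta> * cmod lam) + e"
  define a where "a = vec_norm2 z"
  define b where "b = frobenius_norm B"
  define x where "x = vec_norm2 \<xi>"
  have \<beta>: "cmod \<beta> > 0" and l: "cmod lam > 0" using nz lam by (auto simp: \<beta>_def)
  have a0: "0 \<le> a" and b0: "0 \<le> b" and x0: "0 \<le> x" by (auto simp: a_def b_def x_def)
  have n: "0 < n"
  proof (rule ccontr)
    assume "\<not> 0 < n"
    then show False using nz z B \<xi> by (simp add: scalar_prod_def)
  qed
  \<comment> \<open>The sign of \<open>K\<close> follows from the hypothesis on \<open>K\<close>,
    tested on the pair \<open>1\<^sub>m n\<close>, \<open>0\<^sub>m n n\<close>, whose norm is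
    positive because \<open>n\<close> is.\<close>
  have K0: "0 \<le> K"
  proof -
    have "0 < (\<Sum>i<n. \<Sum>j<n. (cmod ((1\<^sub>m n) $$ (i, j)))\<^sup>2)"
      using n by (intro sum_pos2[of _ 0] sum_nonneg) (auto intro!: sum_pos2[of _ 0])
    also have "\<dots> = (frobenius_norm (1\<^sub>m n))\<^sup>2"
      by (simp add: frobenius_norm_sq)
    finally have "frobenius_norm (1\<^sub>m n) \<noteq> 0" by auto
    then have "0 < frobenius_norm (1\<^sub>m n)"
      using frobenius_norm_nonneg[of "1\<^sub>m n"] by linarith
    then have "0 < frobenius_norm (append_cols (1\<^sub>m n) (0\<^sub>m n n))"
      using frobenius_norm_append_cols_ge(1)[of "1\<^sub>m n" "0\<^sub>m n n"] by simp
    moreover have "0 \<le> K * frobenius_norm (append_cols (1\<^sub>m n) (0\<^sub>m n n))"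
      by (rule order.trans[OF norm_ge_zero K]) auto
    ultimately show ?thesis by (simp add: zero_le_mult_iff)
  qed
  have c: "0 < c" using \<open>0 < e\<close> K0 \<beta> l by (simp add: c_def add_nonneg_pos)
  \<comment> \<open>The slack \<open>e\<close> in \<open>c\<close> makes this strict. It states that
    \<open>g 0 > 0\<close> for the function \<open>g\<close> below, and continuity carries
    positivity over to some \<open>\<delta> > 0\<close>.\<close>
  have "K < c * cmod lam * cmod \<beta>"
    using \<beta> l \<open>0 < e\<close> by (simp add: c_def field_simps)
  \<comment> \<open>\<open>g \<delta> > 0\<close> is what the estimate of \<open>\<Delta>\<lambda>\<close> below needs when \<open>\<epsilon> \<le> \<delta>\<close>.\<close>
  define g where
    "g = (\<lambda>t. c * cmod lam * (cmod \<beta> - a * b * t - a * t * (x + t)) - (K + (1 + cmod lam) * a * t))"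
  have "(g \<longlongrightarrow> g 0) (at_right 0)"
    unfolding g_def by (intro tendsto_intros)
  moreover have "g 0 > 0" using \<open>K < _\<close> by (simp add: g_def)
  ultimately have "\<forall>\<^sub>F t in at_right 0. g t > 0" by (rule order_tendstoD)
  then obtain \<delta> where \<delta>: "\<delta> > 0" "g \<delta> > 0"
    by (metis (mono_tags) dense eventually_at_right_field)
  \<comment> \<open>The set of perturbations puts no direct restriction on the size of
    \<open>dlam\<close>; the bound comes from dividing by its coefficient, which stays away from
    zero for this \<open>\<delta>\<close>.\<close>
  have bound: "cmod dlam \<le> c * cmod lam * \<epsilon>"
    if \<epsilon>: "0 < \<epsilon>" "\<epsilon> \<le> \<delta>" and dlam: "dlam \<in> eigenvalue_perturbations A B lam \<xi> \<delta> \<epsilon>" for \<epsilon> dlam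
  proof -
    obtain dA dB d\<xi> where d: "dA \<in> carrier_mat n n" "dB \<in> carrier_mat n n" "d\<xi> \<in> carrier_vec n"
      and eq: "(A + dA) *\<^sub>v (\<xi> + d\<xi>) = (lam + dlam) \<cdot>\<^sub>v ((B + dB) *\<^sub>v (\<xi> + d\<xi>))"
      and F: "frobenius_norm (append_cols dA dB) \<le> \<epsilon>" and dx: "vec_norm2 d\<xi> \<le> \<delta>"
      using dlam A B by (auto simp: eigenvalue_perturbations_def)
    have FA: "frobenius_norm dA \<le> \<epsilon>" and FB: "frobenius_norm dB \<le> \<epsilon>"
      using frobenius_norm_append_cols_ge[of dA dB] F d by (auto intro: order.trans)
    have form: "cmod (z \<bullet> (M *\<^sub>v v)) \<le> a * (f * r)"
      if "M \<in> carrier_mat n n" "v \<in> carrier_vec n" "frobenius_norm M \<le> f" "vec_norm2 v \<le> r" for M v f r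
    proof -
      have "cmod (z \<bullet> (M *\<^sub>v v)) \<le> a * (frobenius_norm M * vec_norm2 v)"
        unfolding a_def using that z by (intro bilinear_form_bound) auto
      also have "\<dots> \<le> a * (f * r)"
        using that a0 order.trans[OF frobenius_norm_nonneg that(3)]
        by (intro mult_left_mono mult_mono) auto
      finally show ?thesis .
    qed
    define y where "y = \<xi> + d\<xi>"
    have y: "y \<in> carrier_vec n" using \<xi> d by (simp add: y_def)
    have "vec_norm2 y \<le> x + vec_norm2 d\<xi>"
      unfolding y_def x_def using \<xi> d by (intro vec_norm2_add) auto
    then have yn: "vec_norm2 y \<le> x + \<delta>" using dx by linarith
    have split: "z \<bullet> ((M + dM) *\<^sub>v y) = z \<bullet> (M *\<^sub>v y) + z \<bullet> (dM *\<^sub>v y)"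
      if "M \<in> carrier_mat n n" "dM \<in> carrier_mat n n" for M dM
      using that z y by (simp add: add_mult_distrib_mat_vec[of _ n n] scalar_prod_add_distrib[of _ n])
    have split': "z \<bullet> (M *\<^sub>v y) = z \<bullet> (M *\<^sub>v \<xi>) + z \<bullet> (M *\<^sub>v d\<xi>)" if "M \<in> carrier_mat n n" for M
      unfolding y_def
      using that z \<xi> d by (simp add: mult_add_distrib_mat_vec[of _ n n] scalar_prod_add_distrib[of _ n])
    have "z \<bullet> ((A + dA) *\<^sub>v y) = (lam + dlam) * (z \<bullet> ((B + dB) *\<^sub>v y))"
      using eq z y B d unfolding y_def[symmetric] by simp
    \<comment> \<open>The terms \<open>z \<bullet> (A *\<^sub>v y)\<close> and
      \<open>lam * (z \<bullet> (B *\<^sub>v y))\<close> cancel by \<open>left\<close>; then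
      \<open>y\<close> is split into \<open>\<xi>\<close> and \<open>d\<xi>\<close>.\<close>
    then have main: "dlam * (\<beta> + (z \<bullet> (B *\<^sub>v d\<xi>) + z \<bullet> (dB *\<^sub>v y))) =
        (z \<bullet> (dA *\<^sub>v \<xi>) - lam * (z \<bullet> (dB *\<^sub>v \<xi>))) + (z \<bullet> (dA *\<^sub>v d\<xi>) - lam * (z \<bullet> (dB *\<^sub>v d\<xi>)))"
      unfolding split[OF A d(1)] split[OF B d(2)] left[OF y] split'[OF B] split'[OF d(1)] \<beta>_def
      using split'[OF d(2)] by (simp add: algebra_simps)
    have lower: "cmod \<beta> - a * b * \<delta> - a * \<epsilon> * (x + \<delta>) \<le>
        cmod (\<beta> + (z \<bullet> (B *\<^sub>v d\<xi>) + z \<bullet> (dB *\<^sub>v y)))"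
    proof -
      have "cmod (z \<bullet> (B *\<^sub>v d\<xi>)) \<le> a * (b * \<delta>)" "cmod (z \<bullet> (dB *\<^sub>v y)) \<le> a * (\<epsilon> * (x + \<delta>))"
        using B d y yn dx FB by (auto intro!: form simp: b_def)
      moreover have "cmod \<beta> - cmod (z \<bullet> (B *\<^sub>v d\<xi>) + z \<bullet> (dB *\<^sub>v y)) \<le>
          cmod (\<beta> + (z \<bullet> (B *\<^sub>v d\<xi>) + z \<bullet> (dB *\<^sub>v y)))"
        by (rule norm_diff_ineq)
      moreover have "cmod (z \<bullet> (B *\<^sub>v d\<xi>) + z \<bullet> (dB *\<^sub>v y)) \<le> cmod (z \<bullet> (B *\<^sub>v d\<xi>)) + cmod (z \<bullet> (dB *\<^sub>v y))"
        by (rule norm_triangle_ineq)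
      ultimately show ?thesis by (simp add: algebra_simps)
    qed
    have upper: "cmod ((z \<bullet> (dA *\<^sub>v \<xi>) - lam * (z \<bullet> (dB *\<^sub>v \<xi>))) +
          (z \<bullet> (dA *\<^sub>v d\<xi>) - lam * (z \<bullet> (dB *\<^sub>v d\<xi>)))) \<le> \<epsilon> * (K + (1 + cmod lam) * a * \<delta>)"
    proof -
      have 1: "cmod (z \<bullet> (dA *\<^sub>v \<xi>) - lam * (z \<bullet> (dB *\<^sub>v \<xi>))) \<le> K * \<epsilon>"
        by (rule order.trans[OF K[OF d(1,2)] mult_left_mono[OF F K0]])
      have 2: "cmod (z \<bullet> (dA *\<^sub>v d\<xi>)) \<le> a * (\<epsilon> * \<delta>)" "cmod (z \<bullet> (dB *\<^sub>v d\<xi>)) \<le> a * (\<epsilon> * \<delta>)"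
        using d dx FA FB by (auto intro!: form)
      have tri: "cmod (p + (q - lam * r)) \<le> cmod p + (cmod q + cmod lam * cmod r)" for p q r
        using norm_triangle_ineq[of p "q - lam * r"] norm_triangle_ineq4[of q "lam * r"]
        by (simp add: norm_mult)
      show ?thesis
        by (rule order.trans[OF tri], rule order.trans[OF add_mono[OF 1 add_mono[OF 2(1) mult_left_mono[OF 2(2)]]]])
          (simp_all add: algebra_simps)
    qed
    define D where "D = cmod \<beta> - a * b * \<delta> - a * \<epsilon> * (x + \<delta>)"
    define N where "N = K + (1 + cmod lam) * a * \<delta>"
    have N: "0 \<le> N" using K0 a0 \<delta> by (simp add: N_def)
    \<comment> \<open>Replacing \<open>\<epsilon>\<close> by the larger \<open>\<delta>\<close>
      gives a bound independent of \<open>\<epsilon>\<close>, to which \<open>g \<delta> > 0\<close>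
      applies.\<close>
    have "cmod \<beta> - a * b * \<delta> - a * \<delta> * (x + \<delta>) \<le> D"
      unfolding D_def using \<epsilon> a0 x0 \<delta> by (intro diff_left_mono mult_right_mono mult_left_mono) auto
    then have "c * cmod lam * (cmod \<beta> - a * b * \<delta> - a * \<delta> * (x + \<delta>)) \<le> c * cmod lam * D"
      using c l by (intro mult_left_mono) auto
    then have ND: "N < c * cmod lam * D"
      using \<delta>(2) unfolding g_def N_def by linarith
    then have "0 < c * cmod lam * D" using N by linarith
    moreover have "0 < c * cmod lam" using c l by simp
    ultimately have D: "0 < D" using zero_less_mult_pos by blast
    have "cmod dlam * D \<le> cmod (dlam * (\<beta> + (z \<bullet> (B *\<^sub>v d\<xi>) + z \<bullet> (dB *\<^sub>v y))))"
      unfolding norm_mult using lower by (intro mult_left_mono) (auto simp: D_def)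
    also have "\<dots> \<le> \<epsilon> * N"
      unfolding main using upper by (simp add: N_def)
    also have "\<dots> \<le> \<epsilon> * (c * cmod lam * D)"
      using ND \<epsilon> by (intro mult_left_mono) auto
    also have "\<dots> = (c * cmod lam * \<epsilon>) * D" by simp
    finally show ?thesis using D mult_right_le_imp_le by blast
  qed
  \<comment> \<open>The limit over \<open>\<delta>\<close> is an infimum by monotonicity, so one
    suitable \<open>\<delta>\<close> suffices.\<close>
  have "gen_cond A B lam \<xi> \<le> gen_cond_upto A B lam \<xi> \<delta>"
    unfolding gen_cond_eq_INF using \<delta> by (intro INF_lower) auto
  also have "\<dots> \<le> ereal c"
    unfolding gen_cond_upto_def
  proof (rule Limsup_bounded)
    have "\<forall>\<^sub>F \<epsilon> in at_right 0. 0 < \<epsilon> \<and> \<epsilon> \<le> \<delta>"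
      using \<delta> unfolding eventually_at_right_field by (intro exI[of _ \<delta>]) auto
    then show "\<forall>\<^sub>F \<epsilon> in at_right 0. (SUP dlam\<in>eigenvalue_perturbations A B lam \<xi> \<delta> \<epsilon>.
        ereal (cmod dlam / (\<epsilon> * cmod lam))) \<le> ereal c"
    proof eventually_elim
      case (elim \<epsilon>)
      then show ?case
        using bound[of \<epsilon>] l by (intro SUP_least) (simp add: field_simps)
    qed
  qed
  finally show "gen_cond A B lam \<xi> \<le> ereal (K / (cmod (z \<bullet> (B *\<^sub>v \<xi>)) * cmod lam)) + ereal e"
    by (simp add: c_def \<beta>_def)
qed

section \<open>Triangular pairs\<close>

text \<open>A summand with row index \<open>k\<close> and column index \<open>l\<close> can be
  nonzero only if \<open>i \<le> k\<close>, \<open>k \<le> l\<close> and \<open>l \<le> i\<close>,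
  by the support of \<open>y\<close>, the triangular shape of \<open>N\<close> and the support of
  \<open>x\<close> respectively.\<close>

lemma triangular_bilinear_form:
  assumes N: "N \<in> carrier_mat n n" "upper_triangular N" and i: "i < n"
    and y: "y \<in> carrier_vec n" "\<And>j. j < i \<Longrightarrow> y $ j = 0"
    and x: "x \<in> carrier_vec n" "\<And>j. i < j \<Longrightarrow> j < n \<Longrightarrow> x $ j = 0"
  shows "y \<bullet> (N *\<^sub>v x) = y $ i * N $$ (i, i) * (x $ i :: complex)"
proof -
  have zero: "y $ k * (N $$ (k, l) * x $ l) = 0" if "k < n" "l < n" "\<not> (k = i \<and> l = i)" for k l
  proof -
    consider "k < i" | "i < l" | "l < k" using \<open>\<not> (k = i \<and> l = i)\<close> by linarith
    then show ?thesis
    proof cases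
      case 3
      then show ?thesis using N that upper_triangularD[of N l k] by auto
    qed (use y x that in auto)
  qed
  have "y \<bullet> (N *\<^sub>v x) = (\<Sum>k<n. y $ k * (N *\<^sub>v x) $ k)"
    using N by (simp add: scalar_prod_def atLeast0LessThan)
  also have "\<dots> = (\<Sum>k<n. \<Sum>l<n. y $ k * (N $$ (k, l) * x $ l))"
    by (intro sum.cong refl) (simp add: index_mult_mat_vec_sum[OF N(1) x(1)] sum_distrib_left del: index_mult_mat_vec)
  also have "\<dots> = (\<Sum>k<n. if k = i then y $ i * (N $$ (i, i) * x $ i) else 0)"
  proof (intro sum.cong refl)
    fix k assume k: "k \<in> {..<n}"
    have "(\<Sum>l<n. y $ k * (N $$ (k, l) * x $ l)) = (\<Sum>l<n. if l = i then y $ k * (N $$ (k, i) * x $ i) else 0)"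
      using k zero by (intro sum.cong) auto
    also have "\<dots> = y $ k * (N $$ (k, i) * x $ i)" using i by simp
    also have "\<dots> = (if k = i then y $ i * (N $$ (i, i) * x $ i) else 0)" using k zero i by auto
    finally show "(\<Sum>l<n. y $ k * (N $$ (k, l) * x $ l)) = (if k = i then y $ i * (N $$ (i, i) * x $ i) else 0)" .
  qed
  also have "\<dots> = y $ i * N $$ (i, i) * x $ i" using i by simp
  finally show ?thesis .
qed

text \<open>Back substitution from the last index. The alternative in \<open>diag\<close> allows a
  vanishing diagonal entry where \<open>x\<close> is already known to vanish. Thus
  \<open>m = Suc i\<close> locates the support of an eigenvector, and \<open>m = 0\<close> shows
  that its entry \<open>i\<close> is nonzero.\<close>

lemma upper_triangular_null_vec_right:
  fixes M :: "complex mat"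
  assumes M: "M \<in> carrier_mat n n" "upper_triangular M"
    and x: "x \<in> carrier_vec n" "M *\<^sub>v x = 0\<^sub>v n"
    and diag: "\<And>j. m \<le> j \<Longrightarrow> j < n \<Longrightarrow> M $$ (j, j) \<noteq> 0 \<or> x $ j = 0"
  shows "m \<le> j \<Longrightarrow> j < n \<Longrightarrow> x $ j = 0"
proof (induction "n - j" arbitrary: j rule: less_induct)
  case less
  have "(\<Sum>k<n. M $$ (j, k) * x $ k) = (\<Sum>k<n. if k = j then M $$ (j, j) * x $ j else 0)"
  proof (intro sum.cong refl)
    fix k assume k: "k \<in> {..<n}"
    consider "k < j" | "k = j" | "j < k" by linarith
    then show "M $$ (j, k) * x $ k = (if k = j then M $$ (j, j) * x $ j else 0)"
    proof cases
      case 1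
      then show ?thesis using M less.prems upper_triangularD[of M k j] by auto
    next
      case 3
      then have "x $ k = 0" using k less.prems by (intro less.hyps) auto
      then show ?thesis using 3 by simp
    qed simp
  qed
  moreover have "(\<Sum>k<n. M $$ (j, k) * x $ k) = 0"
    using index_mult_mat_vec_sum[OF M(1) x(1) less.prems(2)] x(2) less.prems by simp
  ultimately have "M $$ (j, j) * x $ j = 0" using less.prems by simp
  then show ?case using diag[OF less.prems] by auto
qed

text \<open>Forward substitution, the mirror image of the previous lemma for left null
  vectors.\<close>

lemma upper_triangular_null_vec_left:
  fixes M :: "complex mat"
  assumes M: "M \<in> carrier_mat n n" "upper_triangular M"
    and y: "y \<in> carrier_vec n" "transpose_mat M *\<^sub>v y = 0\<^sub>v n"
    and diag: "\<And>j. j < m \<Longrightarrow> j < n \<Longrightarrow> M $$ (j, j) \<noteq> 0 \<or> y $ j = 0"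
  shows "j < m \<Longrightarrow> j < n \<Longrightarrow> y $ j = 0"
proof (induction j rule: less_induct)
  case (less j)
  note j = less.prems(2)
  have "(\<Sum>k<n. M $$ (k, j) * y $ k) = (\<Sum>k<n. if k = j then M $$ (j, j) * y $ j else 0)"
  proof (intro sum.cong refl)
    fix k assume k: "k \<in> {..<n}"
    consider "k < j" | "k = j" | "j < k" by linarith
    then show "M $$ (k, j) * y $ k = (if k = j then M $$ (j, j) * y $ j else 0)"
    proof cases
      case 1
      then show ?thesis using less.IH[of k] less.prems by simp
    next
      case 3
      then show ?thesis using M k upper_triangularD[of M j k] by auto
    qed simp
  qed
  moreover have "(\<Sum>k<n. M $$ (k, j) * y $ k) = 0"
    using index_mult_mat_vec_sum[of "transpose_mat M" n n, OF _ y(1) j] y(2) j M by simp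
  ultimately have "M $$ (j, j) * y $ j = 0" using j by simp
  then show ?case using diag[OF less.prems] by auto
qed


section \<open>Kronecker products and strictly lower triangular parts\<close>

lemma sum_lessThan_mult:
  fixes f :: "nat \<Rightarrow> 'a :: comm_monoid_add"
  shows "sum f {..<c * b} = (\<Sum>l<c. \<Sum>k<b. f (l * b + k))"
proof (induction c)
  case (Suc c)
  have "sum f {..<Suc c * b} = sum f {..<c * b + b}" by (simp add: add.commute)
  also have "\<dots> = (\<Sum>l<Suc c. \<Sum>k<b. f (l * b + k))"
    by (simp only: sum_lessThan_add Suc.IH sum.lessThan_Suc)
  finally show ?case .
qed simp

lemma kronecker_carrier [simp]:
  "X \<in> carrier_mat a b \<Longrightarrow> Y \<in> carrier_mat c d \<Longrightarrow> kronecker X Y \<in> carrier_mat (a * c) (b * d)"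
  by (simp add: kronecker_def)

lemma vec_stack_carrier [simp]: "M \<in> carrier_mat a b \<Longrightarrow> vec_stack M \<in> carrier_vec (a * b)"
  by (auto simp: vec_stack_def)

lemma M_slvec_carrier [simp]: "M_slvec n \<in> carrier_mat (num_sl n) (n * n)"
  by (simp add: M_slvec_def)

lemma M_slvec_dim [simp]: "dim_row (M_slvec n) = num_sl n" "dim_col (M_slvec n) = n * n"
  by (simp_all add: M_slvec_def)

text \<open>The sum over positions in \<open>vec_stack M\<close> is split as
  \<open>l * b + k\<close>, with column \<open>l\<close> and row \<open>k\<close> of
  \<open>M\<close>; the Kronecker entry then factors and leaves the double sum for
  \<open>X * M * Y\<close>.\<close>

lemma kronecker_mult_vec_stack:
  fixes X M Y :: "complex mat"
  assumes X: "X \<in> carrier_mat a b" and M: "M \<in> carrier_mat b c" and Y: "Y \<in> carrier_mat c d"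
  shows "kronecker (transpose_mat Y) X *\<^sub>v vec_stack M = vec_stack (X * M * Y)"
proof (rule eq_vecI, goal_cases)
  case (1 i)
  have K: "kronecker (transpose_mat Y) X \<in> carrier_mat (d * a) (c * b)"
    using X Y by (intro kronecker_carrier) auto
  have V: "vec_stack M \<in> carrier_vec (c * b)"
    using vec_stack_carrier[OF M] by (simp add: mult.commute)
  have i: "i < d * a" using 1 X Y by (simp add: vec_stack_def mult.commute)
  then have a: "0 < a" by (cases a) auto
  have div: "i div a < d" "i mod a < a" using i a by (auto simp: less_mult_imp_div_less)
  have XM: "X * M \<in> carrier_mat a c" using X M by simp
  have entry: "kronecker (transpose_mat Y) X $$ (i, l * b + k) * vec_stack M $ (l * b + k) =
      X $$ (i mod a, k) * M $$ (k, l) * Y $$ (l, i div a)" if "l < c" "k < b" for l k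
  proof -
    have "l * b + k < Suc l * b" using that by simp
    also have "\<dots> \<le> c * b" using that by (intro mult_le_mono) auto
    finally have "l * b + k < c * b" .
    then show ?thesis
      using X M Y that i div by (simp add: kronecker_def vec_stack_def mult.commute)
  qed
  have "(kronecker (transpose_mat Y) X *\<^sub>v vec_stack M) $ i =
      (\<Sum>q<c * b. kronecker (transpose_mat Y) X $$ (i, q) * vec_stack M $ q)"
    by (rule index_mult_mat_vec_sum[OF K V i])
  also have "\<dots> = (\<Sum>l<c. \<Sum>k<b. X $$ (i mod a, k) * M $$ (k, l) * Y $$ (l, i div a))"
    unfolding sum_lessThan_mult by (intro sum.cong refl) (simp add: entry)
  also have "\<dots> = (\<Sum>l<c. (X * M) $$ (i mod a, l) * Y $$ (l, i div a))"
    using div by (intro sum.cong refl)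
      (simp add: index_mult_mat_sum[OF X M] sum_distrib_right del: index_mult_mat(1))
  also have "\<dots> = (X * M * Y) $$ (i mod a, i div a)"
    by (rule index_mult_mat_sum[OF XM Y div(2,1), symmetric])
  also have "\<dots> = vec_stack (X * M * Y) $ i"
    using X Y i by (simp add: vec_stack_def mult.commute)
  finally show ?case .
qed (use X Y in \<open>simp add: kronecker_def vec_stack_def\<close>)

text \<open>The strictly lower triangular matrix whose \<open>slvec\<close> is \<open>p\<close>. It
  turns the unknown vectors of the linear system with \<open>L_mat\<close> into the matrices
  \<open>P\<close> and \<open>Q\<close>.\<close>

definition lower_mat :: "nat \<Rightarrow> complex vec \<Rightarrow> complex mat" where
  "lower_mat n p = mat n n (\<lambda>(i, j). if j < i then p $ sl_idx n i j else 0)"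

definition slvec :: "nat \<Rightarrow> complex mat \<Rightarrow> complex vec" where
  "slvec n X = M_slvec n *\<^sub>v vec_stack X"

lemma lower_mat_carrier [simp]: "lower_mat n p \<in> carrier_mat n n"
  by (simp add: lower_mat_def)

lemma lower_mat_dim [simp]: "dim_row (lower_mat n p) = n" "dim_col (lower_mat n p) = n"
  by (simp_all add: lower_mat_def)

lemma slvec_carrier [simp]: "slvec n X \<in> carrier_vec (num_sl n)"
  by (simp add: slvec_def M_slvec_def carrier_vecI)

lemma slvec_index:
  assumes "X \<in> carrier_mat n n" "j < i" "i < n"
  shows "slvec n X $ sl_idx n i j = X $$ (i, j)"
  unfolding slvec_def using assms by (rule M_slvec_vec_stack)

lemma sl_idx_cases:
  assumes "s < num_sl n"
  obtains i j where "j < i" "i < n" "s = sl_idx n i j"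
proof -
  have "s \<in> (\<lambda>(i, j). sl_idx n i j) ` {(i, j). j < i \<and> i < n}"
    using assms bij_betw_imp_surj_on[OF sl_idx_bij[of n]] by simp
  then show ?thesis using that by auto
qed

lemma M_slvec_transpose_mult:
  assumes p: "p \<in> carrier_vec (num_sl n)"
  shows "transpose_mat (M_slvec n) *\<^sub>v p = vec_stack (lower_mat n p)"
proof (rule eq_vecI, goal_cases)
  case (1 q)
  then have q: "q < n * n" by (simp add: vec_stack_def lower_mat_def)
  then have n: "0 < n" by (cases n) auto
  define i j where "i = q mod n" and "j = q div n"
  have ij: "i < n" "j < n" "q = i + j * n"
    using q n by (auto simp: i_def j_def less_mult_imp_div_less)
  \<comment> \<open>A column of \<open>M_slvec\<close> holds a single 1 if it belongs to a strictly
    lower position and is zero otherwise.\<close>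
  have entry: "M_slvec n $$ (s, q) = (if s = sl_idx n i j then of_bool (j < i) else 0)"
    if "s < num_sl n" for s
  proof -
    have "i' = i \<and> j' = j" if "i' < n" "q = i' + j' * n" for i' j'
      using that n by (auto simp: i_def j_def)
    then have "(\<exists>i' j'. j' < i' \<and> i' < n \<and> s = sl_idx n i' j' \<and> q = i' + j' * n) \<longleftrightarrow>
        j < i \<and> s = sl_idx n i j"
      using ij by metis
    then show ?thesis using that q by (simp add: M_slvec_def)
  qed
  have "(transpose_mat (M_slvec n) *\<^sub>v p) $ q = (\<Sum>s<num_sl n. transpose_mat (M_slvec n) $$ (q, s) * p $ s)"
    using p q by (intro index_mult_mat_vec_sum[of _ "n * n"]) auto
  also have "\<dots> = (\<Sum>s<num_sl n. if s = sl_idx n i j then of_bool (j < i) * p $ s else 0)"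
    using q by (intro sum.cong refl) (simp add: entry)
  also have "\<dots> = (if j < i then p $ sl_idx n i j else 0)"
    using ij sl_idx_less[of j i n] by simp
  also have "\<dots> = vec_stack (lower_mat n p) $ q"
    using q ij by (simp add: vec_stack_def lower_mat_def flip: i_def j_def)
  finally show ?case .
qed (simp add: vec_stack_def lower_mat_def M_slvec_def)

text \<open>Taking \<open>X\<close> or \<open>Y\<close> to be the identity gives, up to sign, the
  four blocks of \<open>L_mat\<close>.\<close>

lemma slvec_block_mult:
  assumes X: "X \<in> carrier_mat n n" and Y: "Y \<in> carrier_mat n n" and p: "p \<in> carrier_vec (num_sl n)"
  shows "(M_slvec n * kronecker (transpose_mat Y) X * transpose_mat (M_slvec n)) *\<^sub>v p =
    slvec n (X * lower_mat n p * Y)"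
proof -
  have K: "kronecker (transpose_mat Y) X \<in> carrier_mat (n * n) (n * n)"
    using X Y by (intro kronecker_carrier) auto
  have MK: "M_slvec n * kronecker (transpose_mat Y) X \<in> carrier_mat (num_sl n) (n * n)"
    using K M_slvec_carrier[of n] by (rule mult_carrier_mat[rotated])
  have tp: "transpose_mat (M_slvec n) *\<^sub>v p \<in> carrier_vec (n * n)"
    by (simp add: M_slvec_transpose_mult[OF p])
  have "(M_slvec n * kronecker (transpose_mat Y) X * transpose_mat (M_slvec n)) *\<^sub>v p =
      M_slvec n * kronecker (transpose_mat Y) X *\<^sub>v (transpose_mat (M_slvec n) *\<^sub>v p)"
    by (rule assoc_mult_mat_vec[OF MK _ p]) simp
  also have "\<dots> = M_slvec n *\<^sub>v (kronecker (transpose_mat Y) X *\<^sub>v (transpose_mat (M_slvec n) *\<^sub>v p))"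
    using K tp by (rule assoc_mult_mat_vec[OF M_slvec_carrier])
  also have "\<dots> = slvec n (X * lower_mat n p * Y)"
    unfolding M_slvec_transpose_mult[OF p] slvec_def
    by (simp only: kronecker_mult_vec_stack[OF X lower_mat_carrier Y])
  finally show ?thesis .
qed

section \<open>The matrices \<open>L\<close> and \<open>E\<close>\<close>

lemma slvec_kron_carrier:
  assumes "X \<in> carrier_mat n n" "Y \<in> carrier_mat n n"
  shows "M_slvec n * kronecker X Y * transpose_mat (M_slvec n) \<in> carrier_mat (num_sl n) (num_sl n)"
  using assms by (intro mult_carrier_mat[of _ _ "n * n"]) auto

lemma L_mat_carrier:
  assumes "T \<in> carrier_mat n n" "R \<in> carrier_mat n n"
  shows "L_mat n T R \<in> carrier_mat (2 * num_sl n) (2 * num_sl n)"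
  unfolding L_mat_def Let_def mult_2
  using assms by (intro four_block_carrier_mat uminus_carrier_mat slvec_kron_carrier) auto

text \<open>\<open>L_mat\<close> is the coupled Sylvester operator, taking the pair
  \<open>P\<close>, \<open>Q\<close> to \<open>T * Q - P * T\<close> and
  \<open>R * Q - P * R\<close>, followed by restriction to strictly lower parts.\<close>

lemma L_mat_mult:
  assumes T: "T \<in> carrier_mat n n" and R: "R \<in> carrier_mat n n"
    and p: "p \<in> carrier_vec (num_sl n)" and q: "q \<in> carrier_vec (num_sl n)"
  defines "P \<equiv> lower_mat n p" and "Q \<equiv> lower_mat n q"
  shows "L_mat n T R *\<^sub>v (p @\<^sub>v q) =
    (slvec n (T * Q) - slvec n (P * T)) @\<^sub>v (slvec n (R * Q) - slvec n (P * R))"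
proof -
  have left: "- (M_slvec n * kronecker (transpose_mat X) (1\<^sub>m n) * transpose_mat (M_slvec n)) *\<^sub>v p =
      - slvec n (P * X)" if "X \<in> carrier_mat n n" for X
    using slvec_block_mult[OF one_carrier_mat that p] p slvec_kron_carrier[of "transpose_mat X" n "1\<^sub>m n"] that
    by (subst uminus_mult_mat_vec) (auto simp: P_def left_mult_one_mat[OF lower_mat_carrier])
  have right: "(M_slvec n * kronecker (1\<^sub>m n) X * transpose_mat (M_slvec n)) *\<^sub>v q = slvec n (X * Q)"
    if "X \<in> carrier_mat n n" for X
    using slvec_block_mult[OF that one_carrier_mat q] that
    by (simp add: Q_def right_mult_one_mat[OF mult_carrier_mat[OF that lower_mat_carrier]])
  have add: "- slvec n X + slvec n Y = slvec n Y - slvec n X" for X Y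
    by (intro eq_vecI) (simp_all add: carrier_vecD[OF slvec_carrier])
  show ?thesis
    unfolding L_mat_def Let_def
    by (subst four_block_mat_mult_vec[OF uminus_carrier_mat[OF slvec_kron_carrier] slvec_kron_carrier
          uminus_carrier_mat[OF slvec_kron_carrier] slvec_kron_carrier p q])
      (use T R in \<open>auto simp: left right add\<close>)
qed

text \<open>The unknowns decouple: ordering the positions \<open>(i, j)\<close> by \<open>n - i + j\<close>, the equations at
  \<open>(i, j)\<close> form a two-by-two system in \<open>p\<^sub>i\<^sub>j\<close>, \<open>q\<^sub>i\<^sub>j\<close> modulo earlier unknowns.\<close>

lemma sylvester_pair_injective:
  fixes T R P Q :: "complex mat"
  assumes T: "T \<in> carrier_mat n n" "upper_triangular T" and R: "R \<in> carrier_mat n n" "upper_triangular R"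
    and P: "P \<in> carrier_mat n n" and Q: "Q \<in> carrier_mat n n"
    and dist: "\<And>i j. i < n \<Longrightarrow> j < n \<Longrightarrow> i \<noteq> j \<Longrightarrow> T $$ (i, i) * R $$ (j, j) \<noteq> T $$ (j, j) * R $$ (i, i)"
    and eqT: "\<And>i j. j < i \<Longrightarrow> i < n \<Longrightarrow> (T * Q) $$ (i, j) = (P * T) $$ (i, j)"
    and eqR: "\<And>i j. j < i \<Longrightarrow> i < n \<Longrightarrow> (R * Q) $$ (i, j) = (P * R) $$ (i, j)"
  shows "j < i \<Longrightarrow> i < n \<Longrightarrow> P $$ (i, j) = 0 \<and> Q $$ (i, j) = 0"
proof (induction "n - i + j" arbitrary: i j rule: less_induct)
  case less
  have j: "j < n" using less.prems by simp
  have left: "(X * Q) $$ (i, j) = X $$ (i, i) * Q $$ (i, j)"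
    if X: "X \<in> carrier_mat n n" "upper_triangular X" for X
  proof -
    \<comment> \<open>Terms with \<open>k < i\<close> vanish by triangularity, those with
      \<open>k > i\<close> by the induction hypothesis.\<close>
    have "X $$ (i, k) * Q $$ (k, j) = 0" if "k < n" "k \<noteq> i" for k
    proof (cases "k < i")
      case True
      then show ?thesis using X less.prems upper_triangularD by auto
    next
      case False
      then show ?thesis using less.hyps[of k j] less.prems that by simp
    qed
    then have "(\<Sum>k<n. X $$ (i, k) * Q $$ (k, j)) = (\<Sum>k<n. if k = i then X $$ (i, i) * Q $$ (i, j) else 0)"
      by (intro sum.cong) auto
    then show ?thesis
      using less.prems index_mult_mat_sum[OF X(1) Q less.prems(2) j] by simp
  qed
  have right: "(P * X) $$ (i, j) = P $$ (i, j) * X $$ (j, j)"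
    if X: "X \<in> carrier_mat n n" "upper_triangular X" for X
  proof -
    have "P $$ (i, k) * X $$ (k, j) = 0" if "k < n" "k \<noteq> j" for k
    proof (cases "k < j")
      case True
      then show ?thesis using less.hyps[of i k] less.prems by simp
    next
      case False
      then show ?thesis using X that upper_triangularD[of X j k] by auto
    qed
    then have "(\<Sum>k<n. P $$ (i, k) * X $$ (k, j)) = (\<Sum>k<n. if k = j then P $$ (i, j) * X $$ (j, j) else 0)"
      by (intro sum.cong) auto
    then show ?thesis
      using j index_mult_mat_sum[OF P X(1) less.prems(2) j] by simp
  qed
  have 1: "T $$ (i, i) * Q $$ (i, j) = P $$ (i, j) * T $$ (j, j)"
    using eqT[OF less.prems] left[OF T] right[OF T] by simp
  have 2: "R $$ (i, i) * Q $$ (i, j) = P $$ (i, j) * R $$ (j, j)"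
    using eqR[OF less.prems] left[OF R] right[OF R] by simp
  \<comment> \<open>Cramer's rule: the factor is, up to sign, the determinant of the system formed
    by the two preceding equations, and \<open>dist\<close> makes it nonzero.\<close>
  have "Q $$ (i, j) * (T $$ (i, i) * R $$ (j, j) - T $$ (j, j) * R $$ (i, i)) =
      (T $$ (i, i) * Q $$ (i, j)) * R $$ (j, j) - T $$ (j, j) * (R $$ (i, i) * Q $$ (i, j))"
    by (simp add: algebra_simps)
  also have "\<dots> = 0" unfolding 1 2 by simp
  finally have "Q $$ (i, j) * (T $$ (i, i) * R $$ (j, j) - T $$ (j, j) * R $$ (i, i)) = 0" .
  moreover have "P $$ (i, j) * (T $$ (i, i) * R $$ (j, j) - T $$ (j, j) * R $$ (i, i)) = 0"
  proof -
    have "P $$ (i, j) * (T $$ (i, i) * R $$ (j, j) - T $$ (j, j) * R $$ (i, i)) =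
        T $$ (i, i) * (P $$ (i, j) * R $$ (j, j)) - (P $$ (i, j) * T $$ (j, j)) * R $$ (i, i)"
      by (simp add: algebra_simps)
    also have "\<dots> = 0" unfolding 1[symmetric] 2[symmetric] by simp
    finally show ?thesis .
  qed
  ultimately show ?case using dist[OF less.prems(2) j] less.prems by simp
qed

text \<open>A null vector of \<open>L\<close> encodes strictly lower triangular \<open>P\<close>,
  \<open>Q\<close> with both Sylvester expressions zero below the diagonal, so it vanishes by
  \<open>sylvester_pair_injective\<close>. Hence \<open>mat_inverse\<close> does not return
  \<open>None\<close> and \<open>the\<close> yields the actual inverse.\<close>

lemma L_mat_inverse:
  assumes T: "T \<in> carrier_mat n n" "upper_triangular T" and R: "R \<in> carrier_mat n n" "upper_triangular R"
    and dist: "\<And>i j. i < n \<Longrightarrow> j < n \<Longrightarrow> i \<noteq> j \<Longrightarrow> T $$ (i, i) * R $$ (j, j) \<noteq> T $$ (j, j) * R $$ (i, i)"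
  defines "L \<equiv> L_mat n T R"
  shows "the (mat_inverse L) \<in> carrier_mat (2 * num_sl n) (2 * num_sl n)"
    and "L * the (mat_inverse L) = 1\<^sub>m (2 * num_sl n)"
proof -
  have L: "L \<in> carrier_mat (2 * num_sl n) (2 * num_sl n)"
    unfolding L_def using T R by (intro L_mat_carrier)
  have "det L \<noteq> 0"
  proof
    assume "det L = 0"
    then obtain v where v: "v \<in> carrier_vec (2 * num_sl n)" "v \<noteq> 0\<^sub>v (2 * num_sl n)" "L *\<^sub>v v = 0\<^sub>v (2 * num_sl n)"
      using det_0_iff_vec_prod_zero_field[OF L] by auto
    define p q where "p = vec_first v (num_sl n)" and "q = vec_last v (num_sl n)"
    have pq: "p \<in> carrier_vec (num_sl n)" "q \<in> carrier_vec (num_sl n)" by (simp_all add: p_def q_def)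
    have vpq: "v = p @\<^sub>v q" using v(1) by (simp add: p_def q_def mult_2)
    define P Q where "P = lower_mat n p" and "Q = lower_mat n q"
    have PQ: "P \<in> carrier_mat n n" "Q \<in> carrier_mat n n" by (simp_all add: P_def Q_def)
    have "(slvec n (T * Q) - slvec n (P * T)) @\<^sub>v (slvec n (R * Q) - slvec n (P * R)) =
        0\<^sub>v (num_sl n) @\<^sub>v 0\<^sub>v (num_sl n)"
      using v(3) L_mat_mult[OF T(1) R(1) pq] unfolding vpq L_def P_def Q_def
      by (auto simp: mult_2 intro!: eq_vecI)
    then have z: "slvec n (T * Q) - slvec n (P * T) = 0\<^sub>v (num_sl n)"
        "slvec n (R * Q) - slvec n (P * R) = 0\<^sub>v (num_sl n)"
      by (subst (asm) append_vec_eq[of _ "num_sl n"]; auto)+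
    have entry: "(X * Q) $$ (i, j) = (P * X) $$ (i, j)"
      if X: "X \<in> carrier_mat n n" "slvec n (X * Q) - slvec n (P * X) = 0\<^sub>v (num_sl n)"
        and ij: "j < i" "i < n" for X i j
    proof -
      have "(slvec n (X * Q) - slvec n (P * X)) $ sl_idx n i j = 0"
        using X(2) sl_idx_less[OF ij] by simp
      then have "slvec n (X * Q) $ sl_idx n i j = slvec n (P * X) $ sl_idx n i j"
        using sl_idx_less[OF ij] by (simp add: slvec_carrier[THEN carrier_vecD])
      then show ?thesis
        using slvec_index[OF mult_carrier_mat[OF X(1) PQ(2)] ij]
          slvec_index[OF mult_carrier_mat[OF PQ(1) X(1)] ij] by simp
    qed
    have zero: "P $$ (i, j) = 0 \<and> Q $$ (i, j) = 0" if "j < i" "i < n" for i j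
      using T R PQ dist entry[OF T(1) z(1)] entry[OF R(1) z(2)] that
      by (rule sylvester_pair_injective)
    have "p $ s = 0 \<and> q $ s = 0" if "s < num_sl n" for s
      using that
    proof (rule sl_idx_cases)
      fix i j assume ij: "j < i" "i < n" "s = sl_idx n i j"
      then show "p $ s = 0 \<and> q $ s = 0"
        using zero[of j i] by (simp add: P_def Q_def lower_mat_def)
    qed
    then have "v = 0\<^sub>v (2 * num_sl n)"
      using pq unfolding vpq by (intro eq_vecI) auto
    then show False using v(2) by simp
  qed
  then have "L \<in> Units (ring_mat TYPE(complex) (2 * num_sl n) ())"
    by (rule det_non_zero_imp_unit[OF L])
  then obtain Li where "mat_inverse L = Some Li"
    using mat_inverse(1)[OF L, where b = "()"] by (cases "mat_inverse L") auto
  then show "the (mat_inverse L) \<in> carrier_mat (2 * num_sl n) (2 * num_sl n)"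
    and "L * the (mat_inverse L) = 1\<^sub>m (2 * num_sl n)"
    using mat_inverse(2)[OF L] by auto
qed

lemma E_left_mult:
  assumes X: "X \<in> carrier_mat n n" and p: "p \<in> carrier_vec (num_sl n)" and i: "i < n"
  shows "(E_left n X *\<^sub>v p) $ i = - (lower_mat n p * X) $$ (i, i)"
proof -
  have "(E_left n X *\<^sub>v p) $ i = (\<Sum>s<num_sl n. E_left n X $$ (i, s) * p $ s)"
    using p i by (intro index_mult_mat_vec_sum) (auto simp: E_left_def)
  also have "\<dots> = (\<Sum>s<num_sl n. \<Sum>k<i. if s = sl_idx n i k then - X $$ (k, i) * p $ s else 0)"
    using i by (intro sum.cong refl) (auto simp: E_left_def sum_distrib_right intro!: sum.cong)
  also have "\<dots> = (\<Sum>k<i. \<Sum>s<num_sl n. if s = sl_idx n i k then - X $$ (k, i) * p $ s else 0)"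
    by (rule sum.swap)
  also have "\<dots> = (\<Sum>k<i. - X $$ (k, i) * p $ sl_idx n i k)"
    using i sl_idx_less[of _ i n] by (intro sum.cong refl) simp
  also have "\<dots> = (\<Sum>k<n. - X $$ (k, i) * lower_mat n p $$ (i, k))"
    using i by (intro sum.mono_neutral_cong_left) (auto simp: lower_mat_def)
  also have "\<dots> = - (\<Sum>k<n. lower_mat n p $$ (i, k) * X $$ (k, i))"
    by (simp add: sum_negf mult.commute)
  finally show ?thesis
    unfolding index_mult_mat_sum[OF lower_mat_carrier X i i] .
qed

lemma E_right_mult:
  assumes X: "X \<in> carrier_mat n n" and q: "q \<in> carrier_vec (num_sl n)" and i: "i < n"
  shows "(E_right n X *\<^sub>v q) $ i = (X * lower_mat n q) $$ (i, i)"
proof -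
  have "(E_right n X *\<^sub>v q) $ i = (\<Sum>s<num_sl n. E_right n X $$ (i, s) * q $ s)"
    using q i by (intro index_mult_mat_vec_sum) (auto simp: E_right_def)
  also have "\<dots> = (\<Sum>s<num_sl n. \<Sum>k\<in>{i<..<n}. if s = sl_idx n k i then X $$ (i, k) * q $ s else 0)"
    using i by (intro sum.cong refl) (auto simp: E_right_def sum_distrib_right intro!: sum.cong)
  also have "\<dots> = (\<Sum>k\<in>{i<..<n}. \<Sum>s<num_sl n. if s = sl_idx n k i then X $$ (i, k) * q $ s else 0)"
    by (rule sum.swap)
  also have "\<dots> = (\<Sum>k\<in>{i<..<n}. X $$ (i, k) * q $ sl_idx n k i)"
    using sl_idx_less[of i _ n] by (intro sum.cong refl) simp
  also have "\<dots> = (\<Sum>k<n. X $$ (i, k) * lower_mat n q $$ (k, i))"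
    using i by (intro sum.mono_neutral_cong_left) (auto simp: lower_mat_def)
  finally show ?thesis
    unfolding index_mult_mat_sum[OF X lower_mat_carrier i i] .
qed

lemma E_mat_carrier: "E_mat n T R \<in> carrier_mat (2 * n) (2 * num_sl n)"
  unfolding E_mat_def mult_2 by (intro four_block_carrier_mat) (auto simp: E_left_def E_right_def)

text \<open>The counterpart of \<open>L_mat_mult\<close>: where \<open>L_mat\<close> gives the
  strictly lower entries of the two Sylvester expressions, \<open>E_mat\<close> gives their
  diagonals.\<close>

lemma E_mat_mult:
  assumes T: "T \<in> carrier_mat n n" and R: "R \<in> carrier_mat n n"
    and p: "p \<in> carrier_vec (num_sl n)" and q: "q \<in> carrier_vec (num_sl n)" and i: "i < n"
  defines "P \<equiv> lower_mat n p" and "Q \<equiv> lower_mat n q"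
  shows "(E_mat n T R *\<^sub>v (p @\<^sub>v q)) $ i = (T * Q) $$ (i, i) - (P * T) $$ (i, i)"
    and "(E_mat n T R *\<^sub>v (p @\<^sub>v q)) $ (i + n) = (R * Q) $$ (i, i) - (P * R) $$ (i, i)"
proof -
  have c: "E_left n X \<in> carrier_mat n (num_sl n)" "E_right n X \<in> carrier_mat n (num_sl n)" for X
    by (auto simp: E_left_def E_right_def)
  have eq: "E_mat n T R *\<^sub>v (p @\<^sub>v q) =
      (E_left n T *\<^sub>v p + E_right n T *\<^sub>v q) @\<^sub>v (E_left n R *\<^sub>v p + E_right n R *\<^sub>v q)"
    unfolding E_mat_def by (rule four_block_mat_mult_vec[OF c c p q])
  have d: "dim_row (E_left n X) = n" "dim_row (E_right n X) = n" for X
    using c[of X] by auto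
  show "(E_mat n T R *\<^sub>v (p @\<^sub>v q)) $ i = (T * Q) $$ (i, i) - (P * T) $$ (i, i)"
    and "(E_mat n T R *\<^sub>v (p @\<^sub>v q)) $ (i + n) = (R * Q) $$ (i, i) - (P * R) $$ (i, i)"
    unfolding eq P_def Q_def using i E_left_mult[OF T p i] E_right_mult[OF T q i]
      E_left_mult[OF R p i] E_right_mult[OF R q i]
    by (simp_all add: d del: index_mult_mat index_mult_mat_vec)
qed

section \<open>Reduction of a perturbation to triangular form\<close>

definition diag_vec :: "complex mat \<Rightarrow> complex vec" where
  "diag_vec X = vec (dim_row X) (\<lambda>i. X $$ (i, i))"

text \<open>The two vectors list entries of \<open>X\<close> at disjoint sets of positions, each
  position once.\<close>

lemma slvec_diag_norm_le:
  assumes X: "X \<in> carrier_mat n n"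
  shows "(vec_norm2 (slvec n X))\<^sup>2 + (vec_norm2 (diag_vec X))\<^sup>2 \<le> (frobenius_norm X)\<^sup>2"
proof -
  let ?f = "\<lambda>(i, j). (cmod (X $$ (i, j)))\<^sup>2"
  let ?S = "{(i, j). j < i \<and> i < n}" and ?D = "(\<lambda>i. (i, i)) ` {..<n}"
  have fin: "finite ?S" by (rule finite_subset[of _ "{..<n} \<times> {..<n}"]) auto
  have "(vec_norm2 (slvec n X))\<^sup>2 = (\<Sum>s<num_sl n. (cmod (slvec n X $ s))\<^sup>2)"
    by (simp add: vec_norm2_sq carrier_vecD[OF slvec_carrier])
  also have "\<dots> = (\<Sum>p\<in>?S. (cmod (slvec n X $ (case p of (i, j) \<Rightarrow> sl_idx n i j)))\<^sup>2)"
    by (rule sum.reindex_bij_betw[OF sl_idx_bij, symmetric])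
  also have "\<dots> = sum ?f ?S"
    by (intro sum.cong refl) (auto simp: slvec_index[OF X])
  finally have 1: "(vec_norm2 (slvec n X))\<^sup>2 = sum ?f ?S" .
  have 2: "(vec_norm2 (diag_vec X))\<^sup>2 = sum ?f ?D"
    using X by (subst sum.reindex) (auto simp: vec_norm2_sq diag_vec_def inj_on_def)
  have "sum ?f ?S + sum ?f ?D = sum ?f (?S \<union> ?D)"
    using fin by (intro sum.union_disjoint[symmetric]) auto
  also have "\<dots> \<le> sum ?f ({..<n} \<times> {..<n})"
    by (intro sum_mono2) auto
  also have "\<dots> = (frobenius_norm X)\<^sup>2"
    using X by (simp add: frobenius_norm_sq sum.cartesian_product)
  finally show ?thesis unfolding 1 2 .
qed

text \<open>\<open>P\<close> and \<open>Q\<close> come from solving the system with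
  \<open>L_mat\<close> for the strictly lower parts of \<open>dT\<close> and \<open>dR\<close>, so
  the remainders are upper triangular. Their diagonals are those of \<open>dT\<close> and
  \<open>dR\<close> corrected by \<open>E_mat\<close> applied to the solution, hence entries of
  \<open>Z_mat\<close> times a vector no longer than the perturbation.\<close>

lemma triangular_remainder:
  fixes T R dT dR :: "complex mat"
  assumes T: "T \<in> carrier_mat n n" "upper_triangular T" and R: "R \<in> carrier_mat n n" "upper_triangular R"
    and dist: "\<And>i j. i < n \<Longrightarrow> j < n \<Longrightarrow> i \<noteq> j \<Longrightarrow> T $$ (i, i) * R $$ (j, j) \<noteq> T $$ (j, j) * R $$ (i, i)"
    and dT: "dT \<in> carrier_mat n n" and dR: "dR \<in> carrier_mat n n"
  obtains P Q where "P \<in> carrier_mat n n" "Q \<in> carrier_mat n n"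
    "upper_triangular (dT - (T * Q - P * T))" "upper_triangular (dR - (R * Q - P * R))"
    "\<And>i. i < n \<Longrightarrow> cmod ((dT - (T * Q - P * T)) $$ (i, i)) \<le>
      vec_norm2 (row (Z_mat n T R) i) * frobenius_norm (append_cols dT dR)"
    "\<And>i. i < n \<Longrightarrow> cmod ((dR - (R * Q - P * R)) $$ (i, i)) \<le>
      vec_norm2 (row (Z_mat n T R) (i + n)) * frobenius_norm (append_cols dT dR)"
proof -
  define \<nu> where "\<nu> = num_sl n"
  define L where "L = L_mat n T R"
  define Li where "Li = the (mat_inverse L)"
  define E where "E = E_mat n T R"
  have L: "L \<in> carrier_mat (2 * \<nu>) (2 * \<nu>)"
    unfolding L_def \<nu>_def using T R by (intro L_mat_carrier)
  have E: "E \<in> carrier_mat (2 * n) (2 * \<nu>)" unfolding E_def \<nu>_def by (rule E_mat_carrier)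
  have Li: "Li \<in> carrier_mat (2 * \<nu>) (2 * \<nu>)" "L * Li = 1\<^sub>m (2 * \<nu>)"
    unfolding Li_def L_def \<nu>_def using L_mat_inverse[OF T R dist] by auto
  define s where "s = slvec n dT @\<^sub>v slvec n dR"
  have s: "s \<in> carrier_vec (2 * \<nu>)" unfolding s_def mult_2 \<nu>_def by auto
  define w where "w = Li *\<^sub>v s"
  have w: "w \<in> carrier_vec (2 * \<nu>)" unfolding w_def using Li s by simp
  define p q where "p = vec_first w \<nu>" and "q = vec_last w \<nu>"
  have pq: "p \<in> carrier_vec \<nu>" "q \<in> carrier_vec \<nu>" by (simp_all add: p_def q_def)
  have wpq: "w = p @\<^sub>v q" using w by (simp add: p_def q_def mult_2)
  define P Q where "P = lower_mat n p" and "Q = lower_mat n q"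
  have PQ: "P \<in> carrier_mat n n" "Q \<in> carrier_mat n n" by (simp_all add: P_def Q_def)
  have "L *\<^sub>v w = s"
    using assoc_mult_mat_vec[OF L Li(1) s] Li s by (simp add: w_def)
  then have Lw: "slvec n (T * Q) - slvec n (P * T) = slvec n dT" "slvec n (R * Q) - slvec n (P * R) = slvec n dR"
    using L_mat_mult[OF T(1) R(1) pq[unfolded \<nu>_def]] unfolding wpq L_def P_def Q_def s_def
    by (simp_all add: append_vec_eq[of _ "num_sl n"])
  have upper: "upper_triangular (dX - (X * Q - P * X))"
    if X: "X \<in> carrier_mat n n" "dX \<in> carrier_mat n n"
      and eq: "slvec n (X * Q) - slvec n (P * X) = slvec n dX" for X dX
  proof (rule upper_triangularI)
    fix i j assume "j < i" "i < dim_row (dX - (X * Q - P * X))"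
    then have ij: "j < i" "i < n" using X PQ by auto
    have "(X * Q) $$ (i, j) - (P * X) $$ (i, j) = dX $$ (i, j)"
      using arg_cong[OF eq, of "\<lambda>v. v $ sl_idx n i j"] sl_idx_less[OF ij]
        slvec_index[OF mult_carrier_mat[OF X(1) PQ(2)] ij]
        slvec_index[OF mult_carrier_mat[OF PQ(1) X(1)] ij] slvec_index[OF X(2) ij]
      by (simp add: carrier_vecD[OF slvec_carrier] del: index_mult_mat(1))
    then show "(dX - (X * Q - P * X)) $$ (i, j) = 0"
      using X PQ ij by (simp del: index_mult_mat(1))
  qed
  define d where "d = diag_vec dT @\<^sub>v diag_vec dR"
  \<comment> \<open>The minus sign turns the block \<open>E * Li\<close> of \<open>Z_mat\<close>
    into the subtracted correction, so that \<open>Z_mat\<close> applied to \<open>g\<close> is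
    \<open>d - E *\<^sub>v w\<close>.\<close>
  define g where "g = (- s) @\<^sub>v d"
  have d: "d \<in> carrier_vec (2 * n)"
    using dT dR by (auto simp: d_def diag_vec_def mult_2)
  have Z: "row (Z_mat n T R) k = row (E * Li) k @\<^sub>v unit_vec (2 * n) k" if "k < 2 * n" for k
  proof -
    have c: "dim_col (E * Li) = 2 * \<nu>" "dim_col (1\<^sub>m (2 * n)) = 2 * n" using Li by auto
    have "row (Z_mat n T R) k = row (E * Li) k @\<^sub>v row (1\<^sub>m (2 * n)) k"
      unfolding Z_mat_def append_cols_def E_def[symmetric] L_def[symmetric] Li_def[symmetric] c
      by (rule row_four_block_mat(1)[OF mult_carrier_mat[OF E Li(1)] one_carrier_mat
            zero_carrier_mat zero_carrier_mat that])
    then show ?thesis using that by simp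
  qed
  have Zg: "row (Z_mat n T R) k \<bullet> g = d $ k - (E *\<^sub>v w) $ k" if k: "k < 2 * n" for k
  proof -
    have "row (Z_mat n T R) k \<bullet> g = row (E * Li) k \<bullet> (- s) + unit_vec (2 * n) k \<bullet> d"
      unfolding Z[OF k] g_def using E Li s d k by (intro scalar_prod_append row_carrier_vec[of _ "2 * n"]) auto
    also have "row (E * Li) k \<bullet> (- s) = - (row (E * Li) k \<bullet> s)"
      using Li s by simp
    also have "row (E * Li) k \<bullet> s = (E * Li *\<^sub>v s) $ k" using E k by simp
    also have "E * Li *\<^sub>v s = E *\<^sub>v w" unfolding w_def using E Li s by (intro assoc_mult_mat_vec)
    also have "unit_vec (2 * n) k \<bullet> d = d $ k" using d k by simp
    finally show ?thesis by simp
  qed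
  have g_norm: "vec_norm2 g \<le> frobenius_norm (append_cols dT dR)"
  proof (rule power2_le_imp_le)
    have "(vec_norm2 (- s))\<^sup>2 = (vec_norm2 s)\<^sup>2" by (simp add: vec_norm2_sq)
    then show "(vec_norm2 g)\<^sup>2 \<le> (frobenius_norm (append_cols dT dR))\<^sup>2"
      using slvec_diag_norm_le[OF dT] slvec_diag_norm_le[OF dR] dT dR
      unfolding g_def d_def s_def by (simp add: vec_norm2_append frobenius_norm_append_cols)
  qed simp
  have Z_bound: "cmod (row (Z_mat n T R) k \<bullet> g) \<le>
      vec_norm2 (row (Z_mat n T R) k) * frobenius_norm (append_cols dT dR)" if k: "k < 2 * n" for k
  proof -
    have "dim_vec (row (Z_mat n T R) k) = dim_vec g"
      unfolding Z[OF k] g_def using Li s d by simp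
    then have "cmod (row (Z_mat n T R) k \<bullet> g) \<le> vec_norm2 (row (Z_mat n T R) k) * vec_norm2 g"
      by (rule scalar_prod_Cauchy_Schwarz)
    also have "\<dots> \<le> vec_norm2 (row (Z_mat n T R) k) * frobenius_norm (append_cols dT dR)"
      using g_norm by (intro mult_left_mono) auto
    finally show ?thesis .
  qed
  show ?thesis
  proof (rule that[OF PQ upper[OF T(1) dT Lw(1)] upper[OF R(1) dR Lw(2)]])
    fix i assume i: "i < n"
    have "(dT - (T * Q - P * T)) $$ (i, i) = row (Z_mat n T R) i \<bullet> g"
      using Zg[of i] E_mat_mult(1)[OF T(1) R(1) pq[unfolded \<nu>_def] i] i dT dR T PQ
      unfolding wpq E_def P_def Q_def
      by (simp add: d_def diag_vec_def del: index_mult_mat(1) index_mult_mat_vec)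
    then show "cmod ((dT - (T * Q - P * T)) $$ (i, i)) \<le>
        vec_norm2 (row (Z_mat n T R) i) * frobenius_norm (append_cols dT dR)"
      using Z_bound[of i] i by simp
    have "(dR - (R * Q - P * R)) $$ (i, i) = row (Z_mat n T R) (i + n) \<bullet> g"
      using Zg[of "i + n"] E_mat_mult(2)[OF T(1) R(1) pq[unfolded \<nu>_def] i] i dT dR R PQ
      unfolding wpq E_def P_def Q_def
      by (simp add: d_def diag_vec_def del: index_mult_mat(1) index_mult_mat_vec)
    then show "cmod ((dR - (R * Q - P * R)) $$ (i, i)) \<le>
        vec_norm2 (row (Z_mat n T R) (i + n)) * frobenius_norm (append_cols dT dR)"
      using Z_bound[of "i + n"] i by simp
  qed
qed


section \<open>Eigenvectors of the triangular pair\<close>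

lemma pencil_mult_vec:
  fixes T R :: "complex mat"
  assumes "T \<in> carrier_mat n n" "R \<in> carrier_mat n n" "v \<in> carrier_vec n"
  shows "(T - lam \<cdot>\<^sub>m R) *\<^sub>v v = T *\<^sub>v v - lam \<cdot>\<^sub>v (R *\<^sub>v v)"
proof -
  have "lam \<cdot>\<^sub>m R *\<^sub>v v = lam \<cdot>\<^sub>v (R *\<^sub>v v)"
    using assms by (intro eq_vecI) (auto simp: scalar_prod_def sum_distrib_left mult.assoc)
  then show ?thesis
    using assms by (simp add: minus_mult_distrib_mat_vec[of _ n n])
qed

lemma pencil_upper_triangular:
  fixes T R :: "complex mat"
  assumes "T \<in> carrier_mat n n" "R \<in> carrier_mat n n" "upper_triangular T" "upper_triangular R"
  shows "T - lam \<cdot>\<^sub>m R \<in> carrier_mat n n" "upper_triangular (T - lam \<cdot>\<^sub>m R)"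
  using assms upper_triangularD[of T] upper_triangularD[of R] by (auto intro!: upper_triangularI)

text \<open>Regularity makes some \<open>T - \<mu> \<cdot>\<^sub>m R\<close> nonsingular, so no
  diagonal pair is \<open>(0, 0)\<close>. For such pairs equal cross products mean projective
  equality.\<close>

lemma gen_eigenvalues_cross_neq:
  assumes schur: "generalized_schur n A B U V T R" and reg: "regular_pair A B"
    and dist: "distinct_gen_eigenvalues n T R" and ij: "i < n" "j < n" "i \<noteq> j"
  shows "T $$ (i, i) * R $$ (j, j) \<noteq> T $$ (j, j) * R $$ (i, i)"
proof
  have c: "U \<in> carrier_mat n n" "V \<in> carrier_mat n n" "T \<in> carrier_mat n n" "R \<in> carrier_mat n n"
    and up: "upper_triangular T" "upper_triangular R"
    and AB: "A = U * T * mat_adjoint V" "B = U * R * mat_adjoint V"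
    using schur by (auto simp: generalized_schur_def)
  obtain \<mu> where \<mu>: "det (A - \<mu> \<cdot>\<^sub>m B) \<noteq> 0" using reg by (auto simp: regular_pair_def)
  define M where "M = T - \<mu> \<cdot>\<^sub>m R"
  have M: "M \<in> carrier_mat n n" "upper_triangular M"
    unfolding M_def using pencil_upper_triangular[OF c(3,4) up] by auto
  have V: "mat_adjoint V \<in> carrier_mat n n" using c by simp
  have "A - \<mu> \<cdot>\<^sub>m B = U * M * mat_adjoint V"
    unfolding AB M_def using c V
    by (simp add: mult_minus_distrib_mat[of _ n n] minus_mult_distrib_mat[of _ n n] mult_smult_distrib[of _ n n]
        mult_smult_assoc_mat[of _ n n] del: assoc_mult_mat)
  then have "det M \<noteq> 0"
    using \<mu> c M V by (auto simp: det_mult[of _ n])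
  then have Mk: "M $$ (k, k) \<noteq> 0" if "k < n" for k
    using that M by (auto simp: det_upper_triangular[OF M(2,1)] prod_list_zero_iff diag_mat_def)
  then have nz: "T $$ (k, k) \<noteq> 0 \<or> R $$ (k, k) \<noteq> 0" if "k < n" for k
    using Mk[OF that] that c by (cases "R $$ (k, k) = 0") (simp_all add: M_def)
  assume eq: "T $$ (i, i) * R $$ (j, j) = T $$ (j, j) * R $$ (i, i)"
  \<comment> \<open>The scalar is the ratio of the \<open>R\<close> entries, or of the
    \<open>T\<close> entries if \<open>R $$ (j, j) = 0\<close>, which forces
    \<open>R $$ (i, i) = 0\<close> too.\<close>
  have "proj_equal (T $$ (i, i), R $$ (i, i)) (T $$ (j, j), R $$ (j, j))"
  proof (cases "R $$ (j, j) = 0")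
    case True
    then have "T $$ (j, j) \<noteq> 0" "R $$ (i, i) = 0" "T $$ (i, i) \<noteq> 0" using nz ij eq by force+
    then show ?thesis
      using True unfolding proj_equal_def by (intro exI[of _ "T $$ (i, i) / T $$ (j, j)"]) simp
  next
    case False
    then have "R $$ (i, i) \<noteq> 0" using nz[of i] ij eq by auto
    then show ?thesis
      using False eq unfolding proj_equal_def
      by (intro exI[of _ "R $$ (i, i) / R $$ (j, j)"]) (simp add: field_simps)
  qed
  then show False using dist ij by (auto simp: distinct_gen_eigenvalues_def)
qed

text \<open>The pencil at \<open>lam\<close> has a zero on its diagonal at \<open>i\<close> only, so
  its transpose has a null vector. Forward substitution makes it vanish before \<open>i\<close>, and
  everywhere if its entry \<open>i\<close> were zero.\<close>

lemma triangular_left_eigenvector: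
  fixes T R :: "complex mat"
  assumes T: "T \<in> carrier_mat n n" "upper_triangular T" and R: "R \<in> carrier_mat n n" "upper_triangular R"
    and i: "i < n" "T $$ (i, i) = lam * R $$ (i, i)"
    and dist: "\<And>j. j < n \<Longrightarrow> j \<noteq> i \<Longrightarrow> T $$ (j, j) \<noteq> lam * R $$ (j, j)"
  obtains y where "y \<in> carrier_vec n" "y $ i \<noteq> 0" "\<And>j. j < i \<Longrightarrow> y $ j = 0"
    "\<And>v. v \<in> carrier_vec n \<Longrightarrow> y \<bullet> (T *\<^sub>v v) = lam * (y \<bullet> (R *\<^sub>v v))"
proof -
  define M where "M = T - lam \<cdot>\<^sub>m R"
  have M: "M \<in> carrier_mat n n" "upper_triangular M"
    unfolding M_def using pencil_upper_triangular[OF T(1) R(1) T(2) R(2)] by auto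
  have diag: "M $$ (j, j) = T $$ (j, j) - lam * R $$ (j, j)" if "j < n" for j
    using that T R by (simp add: M_def)
  have "M $$ (i, i) \<in> set (diag_mat M)" using i M by (auto simp: diag_mat_def)
  then have "det (transpose_mat M) = 0"
    using i diag[OF i(1)] M by (simp add: det_transpose[of _ n] det_upper_triangular[OF M(2,1)] prod_list_zero_iff)
  then obtain y where y: "y \<in> carrier_vec n" "y \<noteq> 0\<^sub>v n" "transpose_mat M *\<^sub>v y = 0\<^sub>v n"
    using det_0_iff_vec_prod_zero_field[of "transpose_mat M" n] M by auto
  have y0: "y $ j = 0" if "j < i" for j
    using M y(1,3) _ that by (rule upper_triangular_null_vec_left) (use dist diag that i in auto)
  have "y $ i \<noteq> 0"
  proof
    assume yi: "y $ i = 0"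
    have "y $ j = 0" if "j < n" for j
      using M y(1,3) _ that that
      by (rule upper_triangular_null_vec_left) (use yi in \<open>metis diag dist right_minus_eq\<close>)
    then show False using y by auto
  qed
  moreover have "y \<bullet> (T *\<^sub>v v) = lam * (y \<bullet> (R *\<^sub>v v))" if v: "v \<in> carrier_vec n" for v
  proof -
    have "0 = y \<bullet> (M *\<^sub>v v)"
      using transpose_vec_mult_scalar[OF M(1) v y(1)] y(3) v by simp
    also have "\<dots> = y \<bullet> (T *\<^sub>v v) - lam * (y \<bullet> (R *\<^sub>v v))"
      unfolding M_def pencil_mult_vec[OF T(1) R(1) v]
      using T R y v by (subst scalar_prod_minus_distrib[of _ n]) auto
    finally show ?thesis by simp
  qed
  ultimately show ?thesis using that y0 y by blast
qed

text \<open>Sylvester pairs do not contribute: the terms with \<open>Q\<close> cancel because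
  \<open>y\<close> is a left eigenvector, those with \<open>P\<close> because \<open>x\<close> is a
  right one. The upper triangular remainders leave only their entry \<open>(i, i)\<close>.\<close>

lemma triangular_first_order:
  fixes T R dT dR P Q :: "complex mat"
  assumes T: "T \<in> carrier_mat n n" and R: "R \<in> carrier_mat n n"
    and dT: "dT \<in> carrier_mat n n" and dR: "dR \<in> carrier_mat n n"
    and P: "P \<in> carrier_mat n n" and Q: "Q \<in> carrier_mat n n"
    and N1: "upper_triangular (dT - (T * Q - P * T))" and N2: "upper_triangular (dR - (R * Q - P * R))"
    and i: "i < n"
    and y: "y \<in> carrier_vec n" "\<And>j. j < i \<Longrightarrow> y $ j = 0"
    and x: "x \<in> carrier_vec n" "\<And>j. i < j \<Longrightarrow> j < n \<Longrightarrow> x $ j = 0"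
    and left: "\<And>v. v \<in> carrier_vec n \<Longrightarrow> y \<bullet> (T *\<^sub>v v) = lam * (y \<bullet> (R *\<^sub>v v))"
    and right: "T *\<^sub>v x = lam \<cdot>\<^sub>v (R *\<^sub>v x)"
  shows "y \<bullet> (dT *\<^sub>v x) - lam * (y \<bullet> (dR *\<^sub>v x)) =
    y $ i * x $ i * ((dT - (T * Q - P * T)) $$ (i, i) - lam * (dR - (R * Q - P * R)) $$ (i, i))"
proof -
  have split: "y \<bullet> (dX *\<^sub>v x) = y $ i * (dX - (X * Q - P * X)) $$ (i, i) * x $ i +
      (y \<bullet> (X *\<^sub>v (Q *\<^sub>v x)) - y \<bullet> (P *\<^sub>v (X *\<^sub>v x)))"
    if X: "X \<in> carrier_mat n n" and dX: "dX \<in> carrier_mat n n"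
      and N: "upper_triangular (dX - (X * Q - P * X))" for X dX
  proof -
    have c: "X * Q \<in> carrier_mat n n" "P * X \<in> carrier_mat n n" "X * Q - P * X \<in> carrier_mat n n"
      using X P Q by auto
    have NC: "dX - (X * Q - P * X) \<in> carrier_mat n n" by (rule minus_carrier_mat[OF c(3)])
    have "y $ i * (dX - (X * Q - P * X)) $$ (i, i) * x $ i = y \<bullet> ((dX - (X * Q - P * X)) *\<^sub>v x)"
      using triangular_bilinear_form[OF NC N i y x] by simp
    also have "(dX - (X * Q - P * X)) *\<^sub>v x = dX *\<^sub>v x - (X *\<^sub>v (Q *\<^sub>v x) - P *\<^sub>v (X *\<^sub>v x))"
      unfolding minus_mult_distrib_mat_vec[OF dX c(3) x(1)] minus_mult_distrib_mat_vec[OF c(1,2) x(1)]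
        assoc_mult_mat_vec[OF X Q x(1)] assoc_mult_mat_vec[OF P X x(1)] ..
    also have "y \<bullet> \<dots> = y \<bullet> (dX *\<^sub>v x) - (y \<bullet> (X *\<^sub>v (Q *\<^sub>v x)) - y \<bullet> (P *\<^sub>v (X *\<^sub>v x)))"
      using X P Q dX x y by (simp add: scalar_prod_minus_distrib[of _ n])
    finally show ?thesis by simp
  qed
  have "y \<bullet> (P *\<^sub>v (T *\<^sub>v x)) = lam * (y \<bullet> (P *\<^sub>v (R *\<^sub>v x)))"
    unfolding right using P R x y by (simp add: mult_mat_vec[of _ n n])
  moreover have "y \<bullet> (T *\<^sub>v (Q *\<^sub>v x)) = lam * (y \<bullet> (R *\<^sub>v (Q *\<^sub>v x)))"
    using Q x by (intro left) simp
  ultimately show ?thesis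
    unfolding split[OF T dT N1] split[OF R dR N2] by (simp add: algebra_simps del: index_minus_mat)
qed

theorem theorem5:
  fixes n i :: nat and A B U V T R :: "complex mat" and lam :: complex and \<xi> :: "complex vec"
  assumes "2 \<le> n"
    and "A \<in> carrier_mat n n" and "B \<in> carrier_mat n n"
    and "regular_pair A B"
    and "generalized_schur n A B U V T R"
    and "distinct_gen_eigenvalues n T R"
    and "i < n" and "T $$ (i, i) \<noteq> 0" and "R $$ (i, i) \<noteq> 0"
    and "lam = T $$ (i, i) / R $$ (i, i)"
    and "\<xi> \<in> carrier_vec n" and "\<xi> \<noteq> 0\<^sub>v n" and "A *\<^sub>v \<xi> = lam \<cdot>\<^sub>v (B *\<^sub>v \<xi>)"
  shows "gen_cond A B lam \<xi> \<le>
    ereal (vec_norm2 (Matrix.row (Z_mat n T R) i) / cmod (T $$ (i, i))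
         + vec_norm2 (Matrix.row (Z_mat n T R) (i + n)) / cmod (R $$ (i, i)))"
proof -
  note i = \<open>i < n\<close> and t = \<open>T $$ (i, i) \<noteq> 0\<close> and r = \<open>R $$ (i, i) \<noteq> 0\<close>
    and lam = \<open>lam = T $$ (i, i) / R $$ (i, i)\<close> and \<xi> = \<open>\<xi> \<in> carrier_vec n\<close>
  have U: "U \<in> carrier_mat n n" "unitary_mat U" and V: "V \<in> carrier_mat n n" "unitary_mat V"
    and T: "T \<in> carrier_mat n n" "upper_triangular T" and R: "R \<in> carrier_mat n n" "upper_triangular R"
    and AB: "A = U * T * mat_adjoint V" "B = U * R * mat_adjoint V"
    using assms(5) by (auto simp: generalized_schur_def)
  have cross: "T $$ (j, j) * R $$ (k, k) \<noteq> T $$ (k, k) * R $$ (j, j)" if "j < n" "k < n" "j \<noteq> k" for j k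
    using gen_eigenvalues_cross_neq[OF assms(5,4,6) that] .
  have diag_neq: "T $$ (j, j) \<noteq> lam * R $$ (j, j)" if "j < n" "j \<noteq> i" for j
    using cross[OF that(1) i that(2)] r by (auto simp: lam field_simps)
  define US VS where "US = mat_adjoint U" and "VS = mat_adjoint V"
  have US: "US \<in> carrier_mat n n" "unitary_mat US" and VS: "VS \<in> carrier_mat n n"
    using U V unitary_mat_adjoint by (auto simp: US_def VS_def)
  have VVS: "V *\<^sub>v (VS *\<^sub>v v) = v" if "v \<in> carrier_vec n" for v
    using assoc_mult_mat_vec[OF V(1) VS that] unitary_mat_adjoint_right[OF V(2,1)] that
    by (simp add: VS_def)
  have USU: "US *\<^sub>v (U *\<^sub>v v) = v" if "v \<in> carrier_vec n" for v
    using assoc_mult_mat_vec[OF US(1) U(1) that] unitary_mat_adjoint_left[OF U(2,1)] that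
    by (simp add: US_def)
  have schur_mult: "US *\<^sub>v ((U * X * VS) *\<^sub>v v) = X *\<^sub>v (VS *\<^sub>v v)"
    if X: "X \<in> carrier_mat n n" and v: "v \<in> carrier_vec n" for X v
  proof -
    have "(U * X * VS) *\<^sub>v v = U *\<^sub>v (X *\<^sub>v (VS *\<^sub>v v))"
      using U X VS v by (simp add: assoc_mult_mat_vec[of _ n n _ n])
    then show ?thesis using USU[of "X *\<^sub>v (VS *\<^sub>v v)"] X VS v by simp
  qed
  note USA = schur_mult[OF T(1), folded AB(1)[folded VS_def]]
    and USB = schur_mult[OF R(1), folded AB(2)[folded VS_def]]
  define x where "x = VS *\<^sub>v \<xi>"
  have x: "x \<in> carrier_vec n" using VS \<xi> by (simp add: x_def)
  have right: "T *\<^sub>v x = lam \<cdot>\<^sub>v (R *\<^sub>v x)"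
    using arg_cong[OF assms(13), of "\<lambda>v. US *\<^sub>v v"] USA[OF \<xi>] USB[OF \<xi>] US assms(3) \<xi>
    by (simp add: mult_mat_vec[of _ n n] x_def)
  have M: "T - lam \<cdot>\<^sub>m R \<in> carrier_mat n n" "upper_triangular (T - lam \<cdot>\<^sub>m R)"
    using pencil_upper_triangular[OF T(1) R(1) T(2) R(2)] by auto
  have Mx: "(T - lam \<cdot>\<^sub>m R) *\<^sub>v x = 0\<^sub>v n"
    unfolding pencil_mult_vec[OF T(1) R(1) x] right using R x by auto
  have Mdiag: "(T - lam \<cdot>\<^sub>m R) $$ (j, j) \<noteq> 0" if "j < n" "j \<noteq> i" for j
    using diag_neq[OF that] that T R by simp
  have x0: "x $ j = 0" if "i < j" "j < n" for j
    using M x Mx _ Suc_leI[OF that(1)] that(2)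
    by (rule upper_triangular_null_vec_right) (use Mdiag in auto)
  have xi: "x $ i \<noteq> 0"
  proof
    assume xi: "x $ i = 0"
    have "x $ j = 0" if "j < n" for j
      using M x Mx _ le0 that by (rule upper_triangular_null_vec_right) (use Mdiag xi in metis)
    then have "x = 0\<^sub>v n" using x by auto
    moreover have "V *\<^sub>v 0\<^sub>v n = 0\<^sub>v n" using V by (intro eq_vecI) auto
    ultimately have "\<xi> = 0\<^sub>v n" using VVS[OF \<xi>] by (simp add: x_def)
    then show False using assms(12) by simp
  qed
  obtain y where y: "y \<in> carrier_vec n" "y $ i \<noteq> 0" "\<And>j. j < i \<Longrightarrow> y $ j = 0"
    and left: "\<And>v. v \<in> carrier_vec n \<Longrightarrow> y \<bullet> (T *\<^sub>v v) = lam * (y \<bullet> (R *\<^sub>v v))"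
    using triangular_left_eigenvector[OF T R i _ diag_neq] lam r by auto
  \<comment> \<open>A transpose, since \<open>\<bullet>\<close> does not conjugate: it moves
    \<open>US\<close> across the product and makes \<open>z\<close> the left eigenvector
    \<open>y\<close> in the original coordinates.\<close>
  define z where "z = transpose_mat US *\<^sub>v y"
  have z: "z \<in> carrier_vec n" using US y by (simp add: z_def)
  have zv: "z \<bullet> v = y \<bullet> (US *\<^sub>v v)" if "v \<in> carrier_vec n" for v
    unfolding z_def by (rule transpose_vec_mult_scalar[OF US(1) that y(1)])
  have zleft: "z \<bullet> (A *\<^sub>v v) = lam * (z \<bullet> (B *\<^sub>v v))" if "v \<in> carrier_vec n" for v
    using that assms(2,3) VS by (simp add: zv USA USB left)
  have "z \<bullet> (B *\<^sub>v \<xi>) = y \<bullet> (R *\<^sub>v x)"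
    using \<xi> assms(3) by (simp add: zv USB x_def)
  also have "\<dots> = y $ i * R $$ (i, i) * x $ i"
    by (rule triangular_bilinear_form[OF R i y(1,3) x x0])
  finally have \<beta>: "z \<bullet> (B *\<^sub>v \<xi>) = y $ i * R $$ (i, i) * x $ i" .
  define a b where "a = vec_norm2 (row (Z_mat n T R) i)" and "b = vec_norm2 (row (Z_mat n T R) (i + n))"
  \<comment> \<open>The factor \<open>cmod (y $ i * x $ i)\<close> also occurs in
    \<open>\<beta>\<close> and cancels in the final quotient.\<close>
  define K where "K = cmod (y $ i * x $ i) * (a + cmod lam * b)"
  have K: "cmod (z \<bullet> (dA *\<^sub>v \<xi>) - lam * (z \<bullet> (dB *\<^sub>v \<xi>))) \<le> K * frobenius_norm (append_cols dA dB)"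
    if dA: "dA \<in> carrier_mat n n" and dB: "dB \<in> carrier_mat n n" for dA dB
  proof -
    \<comment> \<open>The perturbation in Schur coordinates; unitary invariance keeps its
      norm.\<close>
    define dT dR where "dT = US * dA * V" and "dR = US * dB * V"
    have dT: "dT \<in> carrier_mat n n" and dR: "dR \<in> carrier_mat n n"
      using US dA dB V by (auto simp: dT_def dR_def)
    have norm: "frobenius_norm (US * M * V) = frobenius_norm M" if "M \<in> carrier_mat n n" for M
      using frobenius_norm_unitary_right[OF V(2,1) mult_carrier_mat[OF US(1) that]]
        frobenius_norm_unitary_left[OF US(2,1) that] by simp
    have "(frobenius_norm (append_cols dT dR))\<^sup>2 = (frobenius_norm (append_cols dA dB))\<^sup>2"
      using norm[OF dA] norm[OF dB] dA dB dT dR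
      by (simp add: frobenius_norm_append_cols flip: dT_def dR_def)
    then have F: "frobenius_norm (append_cols dT dR) = frobenius_norm (append_cols dA dB)"
      by (simp add: power2_eq_iff_nonneg)
    define F where "F = frobenius_norm (append_cols dA dB)"
    have zd: "z \<bullet> (M *\<^sub>v \<xi>) = y \<bullet> ((US * M * V) *\<^sub>v x)" if M: "M \<in> carrier_mat n n" for M
    proof -
      have "(US * M * V) *\<^sub>v x = US *\<^sub>v (M *\<^sub>v (V *\<^sub>v x))"
        using US V x M by (simp add: assoc_mult_mat_vec[of _ n n _ n])
      then show ?thesis using zv[of "M *\<^sub>v \<xi>"] M \<xi> VVS[OF \<xi>] by (simp add: x_def)
    qed
    obtain P Q where PQ: "P \<in> carrier_mat n n" "Q \<in> carrier_mat n n"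
      and N: "upper_triangular (dT - (T * Q - P * T))" "upper_triangular (dR - (R * Q - P * R))"
      and bounds: "\<And>k. k < n \<Longrightarrow> cmod ((dT - (T * Q - P * T)) $$ (k, k)) \<le>
        vec_norm2 (row (Z_mat n T R) k) * frobenius_norm (append_cols dT dR)"
        "\<And>k. k < n \<Longrightarrow> cmod ((dR - (R * Q - P * R)) $$ (k, k)) \<le>
        vec_norm2 (row (Z_mat n T R) (k + n)) * frobenius_norm (append_cols dT dR)"
      using cross by (rule triangular_remainder[OF T R _ dT dR]) blast+
    have N1: "cmod ((dT - (T * Q - P * T)) $$ (i, i)) \<le> a * F"
      and N2: "cmod ((dR - (R * Q - P * R)) $$ (i, i)) \<le> b * F"
      using bounds[OF i] by (simp_all only: F a_def b_def F_def)
    have "z \<bullet> (dA *\<^sub>v \<xi>) - lam * (z \<bullet> (dB *\<^sub>v \<xi>)) = y $ i * x $ i *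
        ((dT - (T * Q - P * T)) $$ (i, i) - lam * (dR - (R * Q - P * R)) $$ (i, i))"
      unfolding zd[OF dA] zd[OF dB] dT_def[symmetric] dR_def[symmetric]
      by (rule triangular_first_order[OF T(1) R(1) dT dR PQ N i y(1,3) x x0 left right])
    moreover have "cmod ((dT - (T * Q - P * T)) $$ (i, i) - lam * (dR - (R * Q - P * R)) $$ (i, i)) \<le>
        a * F + cmod lam * (b * F)"
      by (rule order.trans[OF norm_triangle_ineq4 add_mono[OF N1]])
        (simp only: norm_mult mult_left_mono[OF N2] norm_ge_zero)
    ultimately have "cmod (z \<bullet> (dA *\<^sub>v \<xi>) - lam * (z \<bullet> (dB *\<^sub>v \<xi>))) \<le>
        cmod (y $ i * x $ i) * (a * F + cmod lam * (b * F))"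
      by (simp only: norm_mult mult_left_mono norm_ge_zero mult_nonneg_nonneg)
    then show ?thesis by (simp add: K_def F_def algebra_simps)
  qed
  have "gen_cond A B lam \<xi> \<le> ereal (K / (cmod (z \<bullet> (B *\<^sub>v \<xi>)) * cmod lam))"
    using assms(2,3) \<xi> z _ assms(13) zleft _ K
    by (rule gen_cond_le) (use t r xi y(2) in \<open>auto simp: lam \<beta>\<close>)
  \<comment> \<open>Here \<open>lam * R $$ (i, i) = T $$ (i, i)\<close> produces the first
    denominator, while \<open>cmod lam\<close> cancels in the second term.\<close>
  also have "K / (cmod (z \<bullet> (B *\<^sub>v \<xi>)) * cmod lam) = a / cmod (T $$ (i, i)) + b / cmod (R $$ (i, i))"
    unfolding \<beta> K_def lam using t r xi y(2) by (simp add: norm_mult norm_divide field_simps)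
  finally show ?thesis by (simp add: a_def b_def)
qed


end
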